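(* Let $n\ge 3$ be an integer, $\theta\in(0,\pi]$, $f_0>0$, $B\in\mathbb{R}$, $T\subset[-1,1)$, $g:T\to\mathbb{R}$, and let $F\in\mathcal{F}(n,f_0,T,g,B,\theta)$. Then every $(N,n,\theta)$ spherical code satisfies $$N^2\le \frac{F(1,1,1)+3(N-1)\,B+3N\,\hat h(n,\theta,T,g)}{f_0},$$ where $\hat h(n,\theta,T,g)=\max\{h_1,\ldots,h_\mu\}$, $\mu=A(n,\theta,T)$.
   Context: Spherical codes. An $(N,n,\theta)$ spherical code is an $N$-element subset $C$ of the unit sphere $\mathbb{S}^{n-1}\subset\mathbb{R}^n$ such that $c\cdot c'\le\cos\theta$ for all distinct $c,c'\in C$. Matrices $S_k^n$ (Bachoc–Vallentin). Let $P_k^{n-1}$ denote the Gegenbauer polynomial of degree $k$ for dimension $n-1$, i.e. the polynomials orthogonal on $[-1,1]$ with respect to the weight $(1-t^2)^{(n-4)/2}$, normalized by $P_k^{n-1}(1)=1$. Fix $d\ge0$. For $0\le k\le d$ let $Y_k^n(x,y,z)$ be the $(d-k+1)\times(d-k+1)$ matrix with entries, indexed by $0\le i,j\le d-k$, $$\bigl(Y_k^n\bigr)_{ij}(x,y,z)=x^iy^j\bigl((1-x^2)(1-y^2)\bigr)^{k/2}P_k^{n-1}\!\left(\frac{z-xy}{\sqrt{(1-x^2)(1-y^2)}}\right)$$ (which is a polynomial in $x,y,z$), and let $S_k^n(x,y,z)=\frac16\sum_{\sigma}Y_k^n(\sigma(x,y,z))$, the sum being over all $6$ permutations $\sigma$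 of the variables $(x,y,z)$. Write $\langle A,B\rangle=\operatorname{tr}(A^{T}B)$ for matrices $A,B$. Class $\mathrm{BV}(n,f_0)$. For $f_0>0$, $\mathrm{BV}(n,f_0)$ is the class of symmetric real polynomials $F(x,y,z)$ with an expansion (for some $d$) $F(x,y,z)=\sum_{k=0}^d\langle M_k,S_k^n(x,y,z)\rangle$ in which all matrices $M_k$ are positive semidefinite and $M_0-f_0E_0$ is positive semidefinite, where $E_0$ is the matrix whose only nonzero entry is a $1$ in the top left corner. Class $\mathcal{F}$. For $g:T\to\mathbb{R}$ with $T\subset[-1,1)$, put $g_T(x)=g(x)$ if $x\in T$ and $g_T(x)=0$ otherwise. Let $$D(\theta)=\{(x,y,z): -1\le x,y,z\le\cos\theta,\ 1+2xyz-x^2-y^2-z^2\ge0\}.$$ $\mathcal{F}(n,f_0,T,g,B,\theta)$ is the class of symmetric polynomials $F(x,y,z)$ such that: (1) $F\in\mathrm{BV}(n,f_0)$; (2) $F(x,x,1)\le B+2g_T(x)$ for all $x\in[-1,\cos\theta]$; (3) $F(x,y,z)\le g_T(x)+g_T(y)+g_T(z)$ for all $(x,y,z)\in D(\theta)$. The quantity $\hat h$. Fix $e\in\mathbb{S}^{n-1}$ (the choice is irrelevant by rotation invariance). $A(n,\theta,T)$ is the maximal size $N$ of an $(N,n,\theta)$ spherical code $C$ such that $c\cdot e\in T$ for every $c\in C$. For $1\le m\le A(n,\theta,T)$, $Q(m,n,\theta,T)$ is the set of all $(m,n,\theta)$ spherical codes $Y$ such that $y\cdot e\in T$ for every $y\in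 Y$. For $Y=\{y_1,\ldots,y_m\}\in Q(m,n,\theta,T)$ put $H_g(Y)=g(e\cdot y_1)+\cdots+g(e\cdot y_m)$, and let $h_m=h_m(n,\theta,T,g)=\sup_{Y\in Q(m,n,\theta,T)}H_g(Y)$. Then $\hat h(n,\theta,T,g)=\max\{h_1,\ldots,h_\mu\}$ with $\mu=A(n,\theta,T)$.
   Formalization: The bound is proved for N ≥ 1 with max(0, ĥ) in place of ĥ (the empty-code value h_0 = 0 is included, also covering T empty); the literal bound fails when g < 0 on T, e.g. θ=π, T={-1}, g(-1)=-1, F=f_0, B=f_0+2, N=1. *)

theory Defs
  imports
    "HOL-Analysis.Analysis"
    "HOL-Computational_Algebra.Polynomial"
    "Jordan_Normal_Form.Matrix"
begin

definition spherical_code :: "nat \<Rightarrow> real \<Rightarrow> (real ^ 'n) set \<Rightarrow> bool" where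
  "spherical_code N \<theta> C \<longleftrightarrow>
     finite C \<and> card C = N \<and> C \<subseteq> sphere 0 1 \<and>
     (\<forall>c\<in>C. \<forall>c'\<in>C. c \<noteq> c' \<longrightarrow> inner c c' \<le> cos \<theta>)"

(* Gegenbauer polynomial of degree k for dimension m: the weight is
   (1 - t^2) to the power (m - 3) / 2, so m = n - 1 gives exponent (n - 4) / 2.
   For m = 2 the weight is unbounded but integrable; its value at t = -1, 1
   (0 powr a = 0) is immaterial. *)
definition gegenbauer :: "nat \<Rightarrow> nat \<Rightarrow> real poly" where
  "gegenbauer m k = (THE p. degree p = k \<and> poly p 1 = 1 \<and>
     (\<forall>q. degree q < k \<longrightarrow>
        integral {-1..1}
          (\<lambda>t. (1 - t\<^sup>2) powr ((real m - 3) / 2) * poly p t * poly q t) = 0))"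

(* The polynomial form of  q^(k/2) * P (u / sqrt q)  for a polynomial P of degree at
   most k with the parity of k, as is the case for Gegenbauer polynomials: it is
   meaningful for every real q, including q = 0 and q < 0. *)
definition homog_eval :: "real poly \<Rightarrow> nat \<Rightarrow> real \<Rightarrow> real \<Rightarrow> real" where
  "homog_eval P k u q =
     (\<Sum>j\<le>k. if even (k - j) then coeff P j * u ^ j * q ^ ((k - j) div 2) else 0)"

lemma homog_eval_eq:
  assumes deg: "degree P \<le> k"
    and parity: "\<And>j. j \<le> k \<Longrightarrow> odd (k - j) \<Longrightarrow> coeff P j = 0"
    and q: "q > 0"
  shows "homog_eval P k u q = q powr (real k / 2) * poly P (u / sqrt q)"
proof -
  have pw: "q powr (real k / 2) = sqrt q ^ k"
    using q by (simp add: powr_half_sqrt [symmetric] powr_power)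
  have "poly P (u / sqrt q) = (\<Sum>j\<le>k. coeff P j * (u / sqrt q) ^ j)"
    unfolding poly_altdef
    by (rule sum.mono_neutral_left) (use deg in \<open>auto simp: coeff_eq_0\<close>)
  then have "q powr (real k / 2) * poly P (u / sqrt q) =
      (\<Sum>j\<le>k. sqrt q ^ k * (coeff P j * (u / sqrt q) ^ j))"
    by (simp add: pw sum_distrib_left)
  also have "\<dots> = homog_eval P k u q"
    unfolding homog_eval_def
  proof (rule sum.cong [OF refl])
    fix j assume "j \<in> {..k}"
    then have j: "j \<le> k" by simp
    have "sqrt q ^ k = sqrt q ^ (k - j) * sqrt q ^ j"
      using j by (simp flip: power_add)
    then have *: "sqrt q ^ k * (coeff P j * (u / sqrt q) ^ j) =
        coeff P j * u ^ j * sqrt q ^ (k - j)"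
      using q by (simp add: power_divide)
    show "sqrt q ^ k * (coeff P j * (u / sqrt q) ^ j) =
        (if even (k - j) then coeff P j * u ^ j * q ^ ((k - j) div 2) else 0)"
    proof (cases "even (k - j)")
      case True
      then obtain i where "k - j = 2 * i" by (rule evenE)
      then show ?thesis using * q by (simp add: power_mult)
    qed (simp add: parity j)
  qed
  finally show ?thesis by simp
qed

definition Y_mat :: "nat \<Rightarrow> nat \<Rightarrow> nat \<Rightarrow> real \<Rightarrow> real \<Rightarrow> real \<Rightarrow> real mat" where
  "Y_mat n d k x y z = mat (d - k + 1) (d - k + 1)
     (\<lambda>(i, j). x ^ i * y ^ j *
        homog_eval (gegenbauer (n - 1) k) k (z - x * y) ((1 - x\<^sup>2) * (1 - y\<^sup>2)))"

definition S_mat :: "nat \<Rightarrow> nat \<Rightarrow> nat \<Rightarrow> real \<Rightarrow> real \<Rightarrow> real \<Rightarrow> real mat" where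
  "S_mat n d k x y z = (1 / 6) \<cdot>\<^sub>m
     (Y_mat n d k x y z + Y_mat n d k x z y + Y_mat n d k y x z +
      Y_mat n d k y z x + Y_mat n d k z x y + Y_mat n d k z y x)"

definition mat_trace :: "real mat \<Rightarrow> real" where
  "mat_trace A = (\<Sum>i<dim_row A. A $$ (i, i))"

definition mat_inner :: "real mat \<Rightarrow> real mat \<Rightarrow> real" where
  "mat_inner A B = mat_trace (transpose_mat A * B)"

definition pos_semidef :: "nat \<Rightarrow> real mat \<Rightarrow> bool" where
  "pos_semidef r A \<longleftrightarrow>
     A \<in> carrier_mat r r \<and> transpose_mat A = A \<and>
     (\<forall>v \<in> carrier_vec r. 0 \<le> scalar_prod v (A *\<^sub>v v))"

definition E0_mat :: "nat \<Rightarrow> real mat" where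
  "E0_mat r = mat r r (\<lambda>(i, j). if i = 0 \<and> j = 0 then 1 else 0)"

definition symmetric_polynomial3 :: "(real \<Rightarrow> real \<Rightarrow> real \<Rightarrow> real) \<Rightarrow> bool" where
  "symmetric_polynomial3 F \<longleftrightarrow>
     real_polynomial_function (\<lambda>(x, y, z). F x y z) \<and>
     (\<forall>x y z. F x y z = F y x z \<and> F x y z = F x z y)"

definition BV :: "nat \<Rightarrow> real \<Rightarrow> (real \<Rightarrow> real \<Rightarrow> real \<Rightarrow> real) set" where
  "BV n f0 = {F. symmetric_polynomial3 F \<and>
     (\<exists>d M. (\<forall>k\<le>d. pos_semidef (d - k + 1) (M k)) \<and>
            pos_semidef (d + 1) (M 0 - f0 \<cdot>\<^sub>m E0_mat (d + 1)) \<and>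
            (\<forall>x y z. F x y z = (\<Sum>k\<le>d. mat_inner (M k) (S_mat n d k x y z))))}"

(* A function g on T is given by a total function of which only the values on T are used. *)
definition g_ext :: "real set \<Rightarrow> (real \<Rightarrow> real) \<Rightarrow> real \<Rightarrow> real" where
  "g_ext T g x = (if x \<in> T then g x else 0)"

definition D_set :: "real \<Rightarrow> (real \<times> real \<times> real) set" where
  "D_set \<theta> = {(x, y, z). x \<in> {-1..cos \<theta>} \<and> y \<in> {-1..cos \<theta>} \<and> z \<in> {-1..cos \<theta>} \<and>
     1 + 2 * x * y * z - x\<^sup>2 - y\<^sup>2 - z\<^sup>2 \<ge> 0}"

definition F_class ::
  "nat \<Rightarrow> real \<Rightarrow> real set \<Rightarrow> (real \<Rightarrow> real) \<Rightarrow> real \<Rightarrow> real \<Rightarrow> (real \<Rightarrow> real \<Rightarrow> real \<Rightarrow> real) set" where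
  "F_class n f0 T g B \<theta> = {F. symmetric_polynomial3 F \<and> F \<in> BV n f0 \<and>
     (\<forall>x \<in> {-1..cos \<theta>}. F x x 1 \<le> B + 2 * g_ext T g x) \<and>
     (\<forall>(x, y, z) \<in> D_set \<theta>. F x y z \<le> g_ext T g x + g_ext T g y + g_ext T g z)}"

(* The dimension n is CARD('n); e is the fixed reference point on the unit sphere. *)

definition Q_set :: "real ^ 'n \<Rightarrow> nat \<Rightarrow> real \<Rightarrow> real set \<Rightarrow> (real ^ 'n) set set" where
  "Q_set e m \<theta> T = {Y. spherical_code m \<theta> Y \<and> (\<forall>y\<in>Y. inner y e \<in> T)}"

(* The empty code is admitted here, so that the value is 0 if no nonempty code qualifies. *)
definition A_max :: "real ^ 'n \<Rightarrow> real \<Rightarrow> real set \<Rightarrow> nat" where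
  "A_max e \<theta> T = Max {N. \<exists>C. spherical_code N \<theta> C \<and> (\<forall>c\<in>C. inner c e \<in> T)}"

definition H_sum :: "real ^ 'n \<Rightarrow> (real \<Rightarrow> real) \<Rightarrow> (real ^ 'n) set \<Rightarrow> real" where
  "H_sum e g Y = (\<Sum>y\<in>Y. g (inner e y))"

(* Extended reals, since g is an arbitrary function and may be unbounded above. *)
definition h_val :: "real ^ 'n \<Rightarrow> nat \<Rightarrow> real \<Rightarrow> real set \<Rightarrow> (real \<Rightarrow> real) \<Rightarrow> ereal" where
  "h_val e m \<theta> T g = (SUP Y \<in> Q_set e m \<theta> T. ereal (H_sum e g Y))"

(* A finite supremum, i.e. the maximum of the values for m = 1, ..., A_max e \<theta> T if
   A_max e \<theta> T > 0; it is -\<infinity> if A_max e \<theta> T = 0.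
   A point c of a spherical code may have no inner product c . c' in T with another
   code point; it then contributes the empty sum 0, the value for m = 0, which is not
   among the values here.  A bound that sums over the points of a code therefore has to
   use max 0 (h_hat e \<theta> T g), which differs from h_hat e \<theta> T g only if
   T is empty or g is negative on all of T (for T contained in [-1, 1)). *)
definition h_hat :: "real ^ 'n \<Rightarrow> real \<Rightarrow> real set \<Rightarrow> (real \<Rightarrow> real) \<Rightarrow> ereal" where
  "h_hat e \<theta> T g = (SUP m \<in> {1..A_max e \<theta> T}. h_val e m \<theta> T g)"

end

theory Submission
  imports Defs
begin

text \<open>Sum \<open>F\<close> over all triples of code points. Each \<open>S\<^sub>k\<close> contributes a nonnegative amount, because
  for a unit vector \<open>c\<close> the matrices \<open>Y\<^sub>k(c \<cdot> y, c \<cdot> z, y \<cdot> z)\<close> are, up to a positive factor, the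
  blocks of a Gram matrix with rows indexed by pairs \<open>(y, i)\<close>: after projection to the
  orthogonal complement of \<open>c\<close>, the homogenized Gegenbauer polynomial is a harmonic zonal polynomial, and it reproduces itself for the Fischer inner product on homogeneous polynomials.
  The excess of \<open>M\<^sub>0\<close> over \<open>f\<^sub>0 E\<^sub>0\<close> makes the sum at least \<open>f\<^sub>0 N\<^sup>3\<close>. The conditions on \<open>F\<close> bound the
  sum above by \<open>N F(1,1,1) + 3 N (N - 1) B\<close> plus \<open>3 N\<close> times the sum of \<open>g(x \<cdot> y)\<close> over all pairs with
  \<open>x \<cdot> y \<in> T\<close>; rotating \<open>x\<close> to \<open>e\<close> bounds the part belonging to each \<open>x\<close> by \<open>max 0 h\<close>.\<close>

section \<open>Fischer inner product and zonal harmonics\<close>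

definition dderiv :: "'a::real_normed_vector \<Rightarrow> ('a \<Rightarrow> real) \<Rightarrow> 'a \<Rightarrow> real" where
  "dderiv b p x = frechet_derivative p (at x) b"

lemma real_polynomial_function_has_derivative:
  fixes p :: "'a::euclidean_space \<Rightarrow> real"
  assumes "real_polynomial_function p"
  shows "(p has_derivative (\<lambda>b. dderiv b p x)) (at x)"
proof -
  have "p differentiable at x"
    using assms by (simp add: differentiable_at_polynomial_function real_polynomial_function_eq)
  then show ?thesis
    by (simp add: dderiv_def frechet_derivative_works)
qed

lemma dderiv_eqI: "(p has_derivative p') (at x) \<Longrightarrow> dderiv b p x = p' b"
  by (metis dderiv_def frechet_derivative_at)

lemma dderiv_const [simp]: "dderiv b (\<lambda>x. c) = (\<lambda>x. 0)"
  by (rule ext, rule dderiv_eqI [where p' = "\<lambda>_. 0"]) (rule has_derivative_const)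

lemma dderiv_linear: "bounded_linear f \<Longrightarrow> dderiv b f = (\<lambda>x. f b)"
  by (rule ext, rule dderiv_eqI) (rule bounded_linear_imp_has_derivative)

lemma dderiv_add:
  fixes p q :: "'a::euclidean_space \<Rightarrow> real"
  assumes "real_polynomial_function p" "real_polynomial_function q"
  shows "dderiv b (\<lambda>x. p x + q x) = (\<lambda>x. dderiv b p x + dderiv b q x)"
  using has_derivative_add [OF assms [THEN real_polynomial_function_has_derivative]]
  by (intro ext dderiv_eqI)

lemma dderiv_mult:
  fixes p q :: "'a::euclidean_space \<Rightarrow> real"
  assumes "real_polynomial_function p" "real_polynomial_function q"
  shows "dderiv b (\<lambda>x. p x * q x) = (\<lambda>x. p x * dderiv b q x + dderiv b p x * q x)"
  using has_derivative_mult [OF assms [THEN real_polynomial_function_has_derivative]]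
  by (intro ext) (auto dest: dderiv_eqI)

lemma real_polynomial_function_dderiv:
  fixes p :: "'a::euclidean_space \<Rightarrow> real"
  assumes "real_polynomial_function p"
  shows "real_polynomial_function (dderiv b p)"
  using assms
  by induction (auto simp: dderiv_linear dderiv_add dderiv_mult)

lemma dderiv_cmult:
  fixes p :: "'a::euclidean_space \<Rightarrow> real"
  assumes "real_polynomial_function p"
  shows "dderiv b (\<lambda>x. c * p x) = (\<lambda>x. c * dderiv b p x)"
  using dderiv_mult [OF real_polynomial_function.intros(2) assms] by simp

lemma dderiv_sum:
  fixes p :: "'i \<Rightarrow> 'a::euclidean_space \<Rightarrow> real"
  assumes "finite I" "\<And>i. i \<in> I \<Longrightarrow> real_polynomial_function (p i)"
  shows "dderiv b (\<lambda>x. \<Sum>i\<in>I. p i x) = (\<lambda>x. \<Sum>i\<in>I. dderiv b (p i) x)"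
  using assms
proof (induction I rule: finite_induct)
  case (insert i I)
  then have "real_polynomial_function (\<lambda>x. \<Sum>i\<in>I. p i x)"
    by (intro real_polynomial_function_sum) auto
  with insert show ?case
    by (simp add: dderiv_add)
qed simp

lemma dderiv_power:
  fixes p :: "'a::euclidean_space \<Rightarrow> real"
  assumes p: "real_polynomial_function p"
  shows "dderiv b (\<lambda>x. p x ^ n) = (\<lambda>x. real n * p x ^ (n - 1) * dderiv b p x)"
  by (rule ext)
     (use has_derivative_power [OF real_polynomial_function_has_derivative [OF p], of n] in
       \<open>auto dest!: dderiv_eqI [where b = b] simp: mult_ac\<close>)

text \<open>Induction over the construction of the polynomial replaces an analytic argument: in the
  product case both orders expand to the same four terms.\<close>

lemma dderiv_commute:
  fixes p :: "'a::euclidean_space \<Rightarrow> real"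
  assumes "real_polynomial_function p"
  shows "dderiv a (dderiv b p) = dderiv b (dderiv a p)"
  using assms
proof induction
  case (mult f g)
  then show ?case
    by (simp add: dderiv_mult dderiv_add real_polynomial_function_dderiv
        real_polynomial_function.intros(4) algebra_simps)
qed (simp_all add: dderiv_linear dderiv_add real_polynomial_function_dderiv)

text \<open>On polynomials that are homogeneous of degree \<open>k\<close>, this is \<open>k!\<close> times the Fischer inner
  product (with respect to the coordinates in \<open>S\<close>), in which multiplication by a coordinate is
  adjoint to differentiation. Lower and higher degree parts are killed by evaluation at \<open>0\<close>.\<close>

fun fischer :: "'a::euclidean_space set \<Rightarrow> nat \<Rightarrow> ('a \<Rightarrow> real) \<Rightarrow> ('a \<Rightarrow> real) \<Rightarrow> real" where
  "fischer S 0 p q = p 0 * q 0"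
| "fischer S (Suc k) p q = (\<Sum>b\<in>S. fischer S k (dderiv b p) (dderiv b q))"

lemma fischer_commute: "fischer S k p q = fischer S k q p"
  by (induction k arbitrary: p q) (simp_all add: mult.commute)

lemma fischer_add:
  assumes "real_polynomial_function p" "real_polynomial_function p'"
  shows "fischer S k (\<lambda>x. p x + p' x) q = fischer S k p q + fischer S k p' q"
  using assms
  by (induction k arbitrary: p p' q)
     (simp_all add: distrib_right dderiv_add real_polynomial_function_dderiv sum.distrib)

lemma fischer_cmult:
  assumes "real_polynomial_function p"
  shows "fischer S k (\<lambda>x. c * p x) q = c * fischer S k p q"
  using assms
  by (induction k arbitrary: p q)
     (simp_all add: dderiv_cmult real_polynomial_function_dderiv sum_distrib_left)

lemma fischer_zero [simp]: "fischer S k (\<lambda>x. 0) q = 0"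
  using fischer_cmult [of "\<lambda>x. 0" S k 0 q] by auto

lemma fischer_sum:
  assumes "finite I" "\<And>i. i \<in> I \<Longrightarrow> real_polynomial_function (p i)"
  shows "fischer S k (\<lambda>x. \<Sum>i\<in>I. p i x) q = (\<Sum>i\<in>I. fischer S k (p i) q)"
  using assms
proof (induction I rule: finite_induct)
  case (insert i I)
  then have "real_polynomial_function (\<lambda>x. \<Sum>i\<in>I. p i x)"
    by (intro real_polynomial_function_sum) auto
  with insert show ?case
    by (simp add: fischer_add)
qed simp

lemma fischer_sum_right:
  assumes "finite I" "\<And>i. i \<in> I \<Longrightarrow> real_polynomial_function (p i)"
  shows "fischer S k q (\<lambda>x. \<Sum>i\<in>I. p i x) = (\<Sum>i\<in>I. fischer S k q (p i))"
  using fischer_sum [OF assms] by (simp add: fischer_commute [of S k q])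

lemma fischer_cmult_right:
  assumes "real_polynomial_function p"
  shows "fischer S k q (\<lambda>x. c * p x) = c * fischer S k q p"
  using fischer_cmult [OF assms] by (simp add: fischer_commute [of S k q])

text \<open>Unfolded, \<open>fischer S k p q\<close> sums, over all words of k directions from
  \<open>S\<close>, the product of the iterated derivatives of \<open>p\<close> and \<open>q\<close>
  at 0. Each word thus contributes one value of the quadratic form of \<open>M\<close>.\<close>

lemma fischer_psd:
  fixes M :: "nat \<Rightarrow> nat \<Rightarrow> real"
  assumes M: "\<And>v. 0 \<le> (\<Sum>i<r. \<Sum>j<r. M i j * v i * v j)"
  shows "0 \<le> (\<Sum>i<r. \<Sum>j<r. M i j * fischer S k (p i) (p j))"
proof (induction k arbitrary: p)
  case 0
  show ?case using M [of "\<lambda>i. p i 0"] by (simp add: mult.assoc)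
next
  case (Suc k)
  have "(\<Sum>i<r. \<Sum>j<r. M i j * fischer S (Suc k) (p i) (p j)) =
      (\<Sum>i<r. \<Sum>b\<in>S. \<Sum>j<r. M i j * fischer S k (dderiv b (p i)) (dderiv b (p j)))"
    by (simp add: sum_distrib_left, subst sum.swap, rule refl)
  also have "\<dots> = (\<Sum>b\<in>S. \<Sum>i<r. \<Sum>j<r. M i j * fischer S k (dderiv b (p i)) (dderiv b (p j)))"
    by (rule sum.swap)
  also have "\<dots> \<ge> 0"
    by (intro sum_nonneg Suc)
  finally show ?case .
qed

section \<open>Orthonormal coordinates of a subspace and their Laplacian\<close>

definition orthonormal :: "'a::euclidean_space set \<Rightarrow> bool" where
  "orthonormal S \<longleftrightarrow> finite S \<and> (\<forall>a\<in>S. \<forall>b\<in>S. inner a b = of_bool (a = b))"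

lemma sum_orthonormal:
  "orthonormal S \<Longrightarrow> a \<in> S \<Longrightarrow> (\<Sum>b\<in>S. inner b a * f b) = (f a :: real)"
  unfolding orthonormal_def by (subst sum.remove [of S a]) (auto intro!: sum.neutral)

definition laplacian :: "'a::euclidean_space set \<Rightarrow> ('a \<Rightarrow> real) \<Rightarrow> 'a \<Rightarrow> real" where
  "laplacian S p x = (\<Sum>b\<in>S. dderiv b (dderiv b p) x)"

text \<open>For orthonormal \<open>S\<close> this is the inner product of the orthogonal projections
  of \<open>x\<close> and \<open>y\<close> to the span of \<open>S\<close>. That span is later the
  hyperplane orthogonal to a code point, so \<open>card S\<close> plays the part of the
  dimension.\<close>

definition sinner :: "'a::euclidean_space set \<Rightarrow> 'a \<Rightarrow> 'a \<Rightarrow> real" where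
  "sinner S x y = (\<Sum>b\<in>S. inner x b * inner y b)"

lemma real_polynomial_function_inner [intro]: "real_polynomial_function (\<lambda>x. inner x a)"
  by (intro real_polynomial_function.intros(1) bounded_linear_inner_left)

lemma real_polynomial_function_sinner [intro]:
  "finite S \<Longrightarrow> real_polynomial_function (\<lambda>x. sinner S x y)"
  "finite S \<Longrightarrow> real_polynomial_function (\<lambda>x. sinner S x x)"
  unfolding sinner_def by (auto intro!: real_polynomial_function_sum)

text \<open>At 0 only those Leibniz terms survive in which exactly one of the derivatives falls on
  the linear factor, and its direction must be \<open>a\<close>. The factor \<open>Suc k\<close>
  counts the positions of that derivative.\<close>

lemma fischer_mult_inner:
  assumes S: "orthonormal S" and a: "a \<in> S"
    and "real_polynomial_function p" "real_polynomial_function q"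
  shows "fischer S (Suc k) (\<lambda>x. inner x a * p x) q = real (Suc k) * fischer S k p (dderiv a q)"
  using assms(3,4)
proof (induction k arbitrary: p q)
  case 0
  then show ?case
    by (simp add: dderiv_mult real_polynomial_function_inner dderiv_linear bounded_linear_inner_left
        mult.assoc sum_orthonormal [OF S a])
next
  case (Suc k)
  have "fischer S (Suc (Suc k)) (\<lambda>x. inner x a * p x) q =
      (\<Sum>b\<in>S. fischer S (Suc k) (\<lambda>x. inner x a * dderiv b p x + inner b a * p x) (dderiv b q))"
    using Suc.prems
    by (simp add: dderiv_mult real_polynomial_function_inner dderiv_linear bounded_linear_inner_left
             del: fischer.simps(2) add: fischer.simps(2) [of S "Suc k"])
  also have "\<dots> = (\<Sum>b\<in>S. fischer S (Suc k) (\<lambda>x. inner x a * dderiv b p x) (dderiv b q) +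
      inner b a * fischer S (Suc k) p (dderiv b q))"
    using Suc.prems
    by (simp add: fischer_add fischer_cmult real_polynomial_function.intros(4) real_polynomial_function.intros(2)
        real_polynomial_function_inner real_polynomial_function_dderiv del: fischer.simps(2))
  \<comment> \<open>The induction hypothesis gives the first sum. Since derivatives commute, it is
    again \<open>fischer S (Suc k) p (dderiv a q)\<close>; the second summand is the one more copy
    that is required.\<close>
  also have "\<dots> = real (Suc k) * (\<Sum>b\<in>S. fischer S k (dderiv b p) (dderiv b (dderiv a q))) +
      fischer S (Suc k) p (dderiv a q)"
    using Suc.prems
    by (simp add: Suc.IH real_polynomial_function_dderiv sum.distrib sum_distrib_left
        sum_orthonormal [OF S a] dderiv_commute [of q a] del: fischer.simps(2))
  also have "\<dots> = real (Suc (Suc k)) * fischer S (Suc k) p (dderiv a q)"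
    by (simp add: algebra_simps)
  finally show ?case .
qed

text \<open>The squared norm is the sum of the squared coordinates, and
  \<open>fischer_mult_inner\<close> is applied twice for each of them.\<close>

lemma fischer_mult_norm:
  assumes S: "orthonormal S"
    and p: "real_polynomial_function p" and q: "real_polynomial_function q"
  shows "fischer S (Suc (Suc k)) (\<lambda>x. sinner S x x * p x) q =
    real (Suc (Suc k)) * real (Suc k) * fischer S k p (laplacian S q)"
proof -
  have fin: "finite S" using S by (simp add: orthonormal_def)
  have "(\<lambda>x. sinner S x x * p x) = (\<lambda>x. \<Sum>b\<in>S. inner x b * (inner x b * p x))"
    by (simp add: sinner_def sum_distrib_right mult.assoc)
  then have "fischer S (Suc (Suc k)) (\<lambda>x. sinner S x x * p x) q =
      (\<Sum>b\<in>S. fischer S (Suc (Suc k)) (\<lambda>x. inner x b * (inner x b * p x)) q)"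
    using p fin
    by (auto intro!: fischer_sum real_polynomial_function.intros(4) real_polynomial_function_inner
        simp del: fischer.simps)
  also have "\<dots> = (\<Sum>b\<in>S. real (Suc (Suc k)) * (real (Suc k) * fischer S k p (dderiv b (dderiv b q))))"
    by (intro sum.cong refl)
       (use p q S in \<open>simp add: fischer_mult_inner real_polynomial_function.intros(4)
          real_polynomial_function_inner real_polynomial_function_dderiv del: fischer.simps(2)\<close>)
  also have "\<dots> = real (Suc (Suc k)) * real (Suc k) * fischer S k p (laplacian S q)"
    unfolding laplacian_def
    by (subst fischer_sum_right)
       (auto simp: fin q real_polynomial_function_dderiv sum_distrib_left mult.assoc)
  finally show ?thesis .
qed


lemma dderiv_sinner:
  assumes S: "orthonormal S" and b: "b \<in> S"
  shows "dderiv b (\<lambda>x. sinner S x y) = (\<lambda>x. inner y b)"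
    and "dderiv b (\<lambda>x. sinner S x x) = (\<lambda>x. 2 * inner x b)"
proof -
  have fin: "finite S" using S by (simp add: orthonormal_def)
  have bl: "bounded_linear (\<lambda>x. sinner S x y)"
    unfolding sinner_def by (intro bounded_linear_sum bounded_linear_mult_const bounded_linear_inner_left)
  show "dderiv b (\<lambda>x. sinner S x y) = (\<lambda>x. inner y b)"
    using sum_orthonormal [OF S b, of "inner y"]
    by (simp add: dderiv_linear [OF bl]) (simp add: sinner_def inner_commute)
  have "dderiv b (\<lambda>x. \<Sum>a\<in>S. inner x a * inner x a) =
      (\<lambda>x. \<Sum>a\<in>S. dderiv b (\<lambda>x. inner x a * inner x a) x)"
    by (intro dderiv_sum fin real_polynomial_function.intros(4) real_polynomial_function_inner)
  also have "\<dots> = (\<lambda>x. \<Sum>a\<in>S. inner b a * (2 * inner x a))"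
    by (simp add: dderiv_mult real_polynomial_function_inner dderiv_linear bounded_linear_inner_left
        mult_ac)
  also have "\<dots> = (\<lambda>x. 2 * inner x b)"
    using sum_orthonormal [OF S b] by (simp add: inner_commute [of b])
  finally show "dderiv b (\<lambda>x. sinner S x x) = (\<lambda>x. 2 * inner x b)"
    by (simp add: sinner_def)
qed

text \<open>The term with \<open>card S\<close> collects the constant second derivatives of the
  squared norm, and the mixed first derivatives add up to \<open>sinner S x y\<close>, which
  restores the lowered power. The truncated exponents \<open>i - 1\<close> and \<open>j - 2\<close>
  are harmless: their coefficients vanish for \<open>i = 0\<close> and for
  \<open>j < 2\<close>.\<close>

lemma laplacian_zonal_monomial:
  assumes S: "orthonormal S"
  shows "laplacian S (\<lambda>x. sinner S x x ^ i * sinner S x y ^ j) x =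
    2 * real i * (2 * real i + real (card S) + 2 * real j - 2) * sinner S x x ^ (i - 1) * sinner S x y ^ j +
    real j * (real j - 1) * sinner S y y * sinner S x x ^ i * sinner S x y ^ (j - 2)"
proof -
  have fin: "finite S" using S by (simp add: orthonormal_def)
  note rpf = real_polynomial_function_sinner [OF fin] real_polynomial_function_power
    real_polynomial_function.intros(2,3,4) real_polynomial_function_inner
  let ?r = "sinner S x x" and ?s = "sinner S x y"
  have d1: "dderiv b (\<lambda>x. sinner S x x ^ i * sinner S x y ^ j) =
      (\<lambda>x. (2 * real i) * (sinner S x x ^ (i - 1) * (inner x b * sinner S x y ^ j)) +
           (real j * inner y b) * (sinner S x x ^ i * sinner S x y ^ (j - 1)))" if "b \<in> S" for b
    using that
    by (simp add: dderiv_mult dderiv_power rpf dderiv_sinner [OF S] algebra_simps)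
  have d2: "dderiv b (dderiv b (\<lambda>x. sinner S x x ^ i * sinner S x y ^ j)) x =
      (4 * real i * real (i - 1) * ?r ^ (i - 1 - 1) * ?s ^ j) * (inner x b * inner x b) +
      (2 * real i * ?r ^ (i - 1) * ?s ^ j) +
      (4 * real i * real j * ?r ^ (i - 1) * ?s ^ (j - 1)) * (inner x b * inner y b) +
      (real j * real (j - 1) * ?r ^ i * ?s ^ (j - 1 - 1)) * (inner y b * inner y b)" if b: "b \<in> S" for b
  proof -
    have "inner b b = 1" using S b by (auto simp: orthonormal_def)
    then show ?thesis
      unfolding d1 [OF b]
      by (simp add: dderiv_add dderiv_cmult dderiv_mult dderiv_power rpf dderiv_sinner [OF S b]
          dderiv_linear bounded_linear_inner_left algebra_simps)
  qed
  have "laplacian S (\<lambda>x. sinner S x x ^ i * sinner S x y ^ j) x =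
      (4 * real i * real (i - 1) * ?r ^ (i - 1 - 1) * ?s ^ j) * ?r +
      real (card S) * (2 * real i * ?r ^ (i - 1) * ?s ^ j) +
      (4 * real i * real j * ?r ^ (i - 1) * ?s ^ (j - 1)) * ?s +
      (real j * real (j - 1) * ?r ^ i * ?s ^ (j - 1 - 1)) * sinner S y y"
    unfolding laplacian_def sinner_def [of S x x] sinner_def [of S x y] sinner_def [of S y y]
    by (simp only: d2 sum.distrib sum_distrib_left sum_constant cong: sum.cong)
       (simp add: sinner_def sum_distrib_left mult_ac)
  also have "(4 * real i * real (i - 1) * ?r ^ (i - 1 - 1) * ?s ^ j) * ?r =
      4 * real i * (real i - 1) * ?r ^ (i - 1) * ?s ^ j"
  proof (cases i)
    case (Suc i')
    then show ?thesis by (cases i') (simp_all add: algebra_simps)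
  qed simp
  also have "(4 * real i * real j * ?r ^ (i - 1) * ?s ^ (j - 1)) * ?s =
      4 * real i * real j * ?r ^ (i - 1) * ?s ^ j"
    by (cases j) simp_all
  also have "real j * real (j - 1) * ?r ^ i * ?s ^ (j - 1 - 1) * sinner S y y =
      real j * (real j - 1) * sinner S y y * ?r ^ i * ?s ^ (j - 2)"
    by (cases j) (simp_all add: numeral_2_eq_2)
  finally show ?thesis
    by (simp add: algebra_simps)
qed

text \<open>This is the homogenization \<open>|x|^k |y|^k P(x . y / (|x| |y|))\<close>, with norms
  and products taken in the span of \<open>S\<close>, of the polynomial P that has the coefficients
  \<open>c j\<close> for \<open>j\<close> of the parity of \<open>k\<close>.\<close>

definition zonal :: "'a::euclidean_space set \<Rightarrow> (nat \<Rightarrow> real) \<Rightarrow> nat \<Rightarrow> 'a \<Rightarrow> 'a \<Rightarrow> real" where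
  "zonal S c k y x = (\<Sum>i\<le>k div 2. c (k - 2 * i) * sinner S y y ^ i *
     (sinner S x x ^ i * sinner S x y ^ (k - 2 * i)))"

lemma real_polynomial_function_zonal_monomial:
  "finite S \<Longrightarrow> real_polynomial_function (\<lambda>x. sinner S x x ^ i * sinner S x y ^ j)"
  by (intro real_polynomial_function.intros(4) real_polynomial_function_power
      real_polynomial_function_sinner)

lemma real_polynomial_function_zonal:
  "finite S \<Longrightarrow> real_polynomial_function (zonal S c k y)"
  unfolding zonal_def [abs_def]
  by (intro real_polynomial_function_sum finite_atMost real_polynomial_function.intros(4)
      real_polynomial_function.intros(2) real_polynomial_function_power real_polynomial_function_sinner)

text \<open>The Laplacians of neighbouring summands share a monomial in \<open>sinner S x x\<close>
  and \<open>sinner S x y\<close>; the recursion says that the total coefficient of each such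
  monomial is 0.\<close>

lemma laplacian_zonal:
  assumes S: "orthonormal S"
    and rec: "\<And>j. j + 2 \<le> k \<Longrightarrow>
      (real j + 2) * (real j + 1) * c (j + 2) + (real k - real j) * (real k + real j + real (card S) - 2) * c j = 0"
  shows "laplacian S (zonal S c k y) = (\<lambda>x. 0)"
proof
  fix x
  have fin: "finite S" using S by (simp add: orthonormal_def)
  note rpf = real_polynomial_function_zonal_monomial [OF fin] real_polynomial_function_dderiv
    real_polynomial_function.intros(2,4)
  let ?r = "sinner S x x" and ?s = "sinner S x y" and ?K = "k div 2"
  define a where "a i = c (k - 2 * i) * sinner S y y ^ i *
      (2 * real i * (2 * real i + real (card S) + 2 * real (k - 2 * i) - 2) *
        ?r ^ (i - 1) * ?s ^ (k - 2 * i))" for i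
  define b where "b i = c (k - 2 * i) * sinner S y y ^ i *
      (real (k - 2 * i) * (real (k - 2 * i) - 1) * sinner S y y * ?r ^ i * ?s ^ (k - 2 * i - 2))" for i
  have "laplacian S (zonal S c k y) x = (\<Sum>i\<le>?K. c (k - 2 * i) * sinner S y y ^ i *
      laplacian S (\<lambda>x. sinner S x x ^ i * sinner S x y ^ (k - 2 * i)) x)"
    unfolding laplacian_def zonal_def [abs_def]
    by (simp add: dderiv_sum dderiv_cmult rpf) (subst sum.swap, simp add: sum_distrib_left)
  also have "\<dots> = (\<Sum>i\<le>?K. a i + b i)"
    by (simp add: laplacian_zonal_monomial [OF S] a_def b_def distrib_left)
  \<comment> \<open>Shifting the index of \<open>a\<close> pairs the summands that belong to the
    same monomial and leaves one boundary term at each end.\<close>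
  also have "\<dots> = (\<Sum>i<?K. b i + a (Suc i)) + a 0 + b ?K"
    unfolding sum.distrib sum.atMost_shift [of a]
    by (simp add: lessThan_Suc_atMost [symmetric])
  also have "(\<Sum>i<?K. b i + a (Suc i)) = 0"
  proof (rule sum.neutral, rule ballI)
    fix i assume "i \<in> {..<?K}"
    then have i: "2 * i + 2 \<le> k" by auto
    define j where "j = k - 2 * i - 2"
    have j: "k = 2 * i + j + 2" using i by (simp add: j_def)
    have "b i + a (Suc i) = sinner S y y ^ Suc i * ?r ^ i * ?s ^ j *
        ((real j + 2) * (real j + 1) * c (j + 2) + (real k - real j) * (real k + real j + real (card S) - 2) * c j)"
      by (simp add: a_def b_def j algebra_simps)
    then show "b i + a (Suc i) = 0"
      using rec [of j] j by simp
  qed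
  also have "a 0 = 0" by (simp add: a_def)
  \<comment> \<open>The remaining exponent \<open>k - 2 * ?K\<close> is 0 or 1, so its
    second-derivative factor vanishes.\<close>
  also have "b ?K = 0"
  proof -
    have "k - 2 * ?K = 0 \<or> k - 2 * ?K = 1" by presburger
    then show ?thesis by (auto simp: b_def)
  qed
  finally show "laplacian S (zonal S c k y) x = 0" by simp
qed

text \<open>Pairing with a power of the linear form given by \<open>y\<close> is evaluation at
  \<open>y\<close>, up to a constant. For \<open>i = 0\<close> each derivative takes one factor from
  both powers, and summing over the directions produces \<open>sinner S y w\<close>. A factor
  \<open>sinner S x x\<close> moves across as the Laplacian, which turns the power of the linear
  form into a lower one times \<open>sinner S y y\<close>.\<close>

lemma fischer_zonal_monomial:
  assumes S: "orthonormal S"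
  shows "fischer S (2 * i + j) (\<lambda>x. sinner S x y ^ (2 * i + j))
      (\<lambda>x. sinner S x x ^ i * sinner S x w ^ j) =
    (fact (2 * i + j))\<^sup>2 * sinner S y y ^ i * sinner S y w ^ j"
proof (induction i)
  case 0
  have fin: "finite S" using S by (simp add: orthonormal_def)
  show ?case
  proof (induction j)
    case (Suc j)
    have "fischer S (Suc j) (\<lambda>x. sinner S x y ^ Suc j) (\<lambda>x. sinner S x w ^ Suc j) =
        (\<Sum>b\<in>S. (real (Suc j) * inner y b) * ((real (Suc j) * inner w b) *
           fischer S j (\<lambda>x. sinner S x y ^ j) (\<lambda>x. sinner S x w ^ j)))"
    proof (simp only: fischer.simps, rule sum.cong [OF refl])
      fix b assume b: "b \<in> S"
      have d: "dderiv b (\<lambda>x. sinner S x z ^ Suc j) = (\<lambda>x. (real (Suc j) * inner z b) * sinner S x z ^ j)" for z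
        using b by (simp add: dderiv_power real_polynomial_function_sinner fin dderiv_sinner [OF S]
            mult_ac del: power_Suc)
      show "fischer S j (dderiv b (\<lambda>x. sinner S x y ^ Suc j)) (dderiv b (\<lambda>x. sinner S x w ^ Suc j)) =
          (real (Suc j) * inner y b) * ((real (Suc j) * inner w b) *
           fischer S j (\<lambda>x. sinner S x y ^ j) (\<lambda>x. sinner S x w ^ j))"
        unfolding d
        by (simp only: fischer_cmult fischer_cmult_right real_polynomial_function_power
            real_polynomial_function_sinner fin)
    qed
    also have "\<dots> = (real (Suc j))\<^sup>2 * sinner S y w * ((fact j)\<^sup>2 * sinner S y w ^ j)"
      using Suc by (simp add: sinner_def [of S y w] sum_distrib_left sum_distrib_right
          power2_eq_square mult_ac)
    finally show ?case
      by (simp add: power2_eq_square algebra_simps)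
  qed simp
next
  case (Suc i)
  have fin: "finite S" using S by (simp add: orthonormal_def)
  let ?n = "2 * i + j"
  have lap: "laplacian S (\<lambda>x. sinner S x y ^ Suc (Suc ?n)) =
      (\<lambda>x. (real (Suc (Suc ?n)) * real (Suc ?n) * sinner S y y) * sinner S x y ^ ?n)"
    using laplacian_zonal_monomial [OF S, of 0 y "Suc (Suc ?n)"]
    by (intro ext) (simp add: algebra_simps)
  have "fischer S (Suc (Suc ?n)) (\<lambda>x. sinner S x y ^ Suc (Suc ?n))
      (\<lambda>x. sinner S x x * (sinner S x x ^ i * sinner S x w ^ j)) =
     real (Suc (Suc ?n)) * real (Suc ?n) * (real (Suc (Suc ?n)) * real (Suc ?n) * sinner S y y *
       fischer S ?n (\<lambda>x. sinner S x y ^ ?n) (\<lambda>x. sinner S x x ^ i * sinner S x w ^ j))"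
    by (subst fischer_commute, subst fischer_mult_norm [OF S])
       (simp_all only: real_polynomial_function_zonal_monomial real_polynomial_function_power
          real_polynomial_function_sinner fin lap fischer_cmult_right,
        simp only: fischer_commute)
  then show ?case
    using Suc by (simp add: power2_eq_square mult_ac del: fischer.simps of_nat_Suc)
qed

text \<open>Only the leading term of the first argument contributes, as the other terms are
  multiples of the squared norm, whose adjoint is the Laplacian.\<close>

lemma fischer_zonal:
  assumes S: "orthonormal S"
    and rec: "\<And>j. j + 2 \<le> k \<Longrightarrow>
      (real j + 2) * (real j + 1) * c (j + 2) + (real k - real j) * (real k + real j + real (card S) - 2) * c j = 0"
  shows "fischer S k (zonal S c k y) (zonal S c k w) = c k * (fact k)\<^sup>2 * zonal S c k w y"
proof -
  have fin: "finite S" using S by (simp add: orthonormal_def)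
  note rpf = real_polynomial_function_zonal_monomial [OF fin] real_polynomial_function_zonal [OF fin]
    real_polynomial_function.intros(2,4)
  let ?q = "\<lambda>y i x. sinner S x x ^ i * sinner S x y ^ (k - 2 * i)"
  have z: "zonal S c k z = (\<lambda>x. \<Sum>i\<le>k div 2. (c (k - 2 * i) * sinner S z z ^ i) * ?q z i x)" for z
    by (simp add: zonal_def [abs_def])
  have higher: "fischer S k (?q y i) (zonal S c k w) = 0" if i: "i \<in> {..k div 2}" "i \<noteq> 0" for i
  proof -
    obtain i' where i': "i = Suc i'" using i not0_implies_Suc by blast
    have "2 \<le> k" using i by auto
    then obtain k' where k': "k = Suc (Suc k')" by (metis add_2_eq_Suc le_Suc_ex)
    have "fischer S k (\<lambda>x. sinner S x x * (sinner S x x ^ i' * sinner S x y ^ (k - 2 * i)))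
        (zonal S c k w) = 0"
      using fischer_mult_norm [OF S, of "\<lambda>x. sinner S x x ^ i' * sinner S x y ^ (k - 2 * i)"
          "zonal S c k w" k']
      by (simp add: rpf k' [symmetric] laplacian_zonal [OF S rec] fischer_commute [of S k' _ "\<lambda>x. 0"]
          del: fischer.simps)
    then show ?thesis by (simp add: i' mult.assoc)
  qed
  have "fischer S k (zonal S c k y) (zonal S c k w) =
      (\<Sum>i\<le>k div 2. (c (k - 2 * i) * sinner S y y ^ i) * fischer S k (?q y i) (zonal S c k w))"
    unfolding z [of y] by (simp add: fischer_sum fischer_cmult rpf)
  also have "\<dots> = c k * fischer S k (\<lambda>x. sinner S x y ^ k) (zonal S c k w)"
    by (subst sum.remove [of _ 0]) (auto intro!: sum.neutral simp: higher)
  also have "fischer S k (\<lambda>x. sinner S x y ^ k) (zonal S c k w) =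
      (\<Sum>i\<le>k div 2. (c (k - 2 * i) * sinner S w w ^ i) * fischer S k (\<lambda>x. sinner S x y ^ k) (?q w i))"
    unfolding z [of w] by (simp add: fischer_sum_right fischer_cmult_right rpf)
  \<comment> \<open>Evaluation at \<open>y\<close>, monomial by monomial, turns
    \<open>zonal S c k w\<close> into its value there.\<close>
  also have "\<dots> = (fact k)\<^sup>2 * zonal S c k w y"
  proof -
    have "fischer S k (\<lambda>x. sinner S x y ^ k) (?q w i) =
        (fact k)\<^sup>2 * (sinner S y y ^ i * sinner S y w ^ (k - 2 * i))" if "i \<le> k div 2" for i
    proof -
      have "2 * i + (k - 2 * i) = k" using that by auto
      then show ?thesis
        using fischer_zonal_monomial [OF S, of i "k - 2 * i" y w] by simp
    qed
    then show ?thesis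
      by (simp add: zonal_def sum_distrib_left mult_ac)
  qed
  finally show ?thesis by simp
qed

section \<open>Gegenbauer polynomials\<close>

lemma pderiv_pcompose_linear:
  fixes p :: "real poly"
  shows "pderiv (pcompose p [:a, b:]) = Polynomial.smult b (pcompose (pderiv p) [:a, b:])"
proof (induction p)
  case (pCons c p)
  then show ?case
    by (simp add: pcompose_pCons pderiv_add pderiv_mult pderiv_pCons pderiv_smult pcompose_add
        smult_add_right algebra_simps)
qed simp

text \<open>Coefficients of the hypergeometric series 2F1(-k, k+m-2; (m-1)/2; u/2) in powers of u.
  The factor \<open>real k - real r\<close> terminates it after the power k.\<close>

fun gegen_coeff :: "nat \<Rightarrow> nat \<Rightarrow> nat \<Rightarrow> real" where
  "gegen_coeff m k 0 = 1"
| "gegen_coeff m k (Suc r) =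
    - ((real k - real r) * (real k + real r + real m - 2) / ((real r + 1) * (2 * real r + real m - 1)))
      * gegen_coeff m k r"

lemma gegen_coeff_eq_0: "r > k \<Longrightarrow> gegen_coeff m k r = 0"
proof (induction r)
  case (Suc r)
  then show ?case by (cases "r = k") auto
qed simp

text \<open>Below \<open>r = k\<close> the quotient in the recursion is positive, so the signs
  alternate. The substitution u = 1 - t cancels the alternation, which makes the leading coefficient
  of \<open>gegen\<close> positive.\<close>

lemma gegen_coeff_sign:
  assumes "m \<ge> 2" "r \<le> k"
  shows "(- 1) ^ r * gegen_coeff m k r > 0"
  using assms(2)
proof (induction r)
  case (Suc r)
  have "(- 1) ^ Suc r * gegen_coeff m k (Suc r) =
     ((real k - real r) * (real k + real r + real m - 2) / ((real r + 1) * (2 * real r + real m - 1)))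
      * ((- 1) ^ r * gegen_coeff m k r)"
    by simp
  also have "\<dots> > 0"
    by (intro mult_pos_pos [OF divide_pos_pos] mult_pos_pos [of "real k - real r"]
        mult_pos_pos [of "real r + 1"] Suc.IH) (use Suc.prems assms(1) in auto)
  finally show ?case .
qed simp

definition gegen_base :: "nat \<Rightarrow> nat \<Rightarrow> real poly" where
  "gegen_base m k = (\<Sum>r\<le>k. monom (gegen_coeff m k r) r)"

text \<open>The hypergeometric form of the Gegenbauer polynomial, expanded at the point \<open>1\<close>.\<close>

definition gegen :: "nat \<Rightarrow> nat \<Rightarrow> real poly" where
  "gegen m k = pcompose (gegen_base m k) [:1, - 1:]"

lemma coeff_gegen_base: "coeff (gegen_base m k) r = gegen_coeff m k r"
  by (simp add: gegen_base_def coeff_sum gegen_coeff_eq_0)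

lemma degree_gegen_base: "m \<ge> 2 \<Longrightarrow> degree (gegen_base m k) = k"
  using gegen_coeff_sign [of m k k]
  by (intro antisym degree_le le_degree) (auto simp: coeff_gegen_base gegen_coeff_eq_0)

lemma degree_gegen: "m \<ge> 2 \<Longrightarrow> degree (gegen m k) = k"
  by (simp add: gegen_def degree_pcompose degree_gegen_base)

lemma lead_coeff_gegen: 
  assumes "m \<ge> 2"
  shows "coeff (gegen m k) k > 0"
proof -
  have "lead_coeff (gegen m k) = lead_coeff (gegen_base m k) * (- 1) ^ degree (gegen_base m k)"
    unfolding gegen_def by (subst lead_coeff_comp) auto
  then show ?thesis
    using gegen_coeff_sign [OF assms, of k k]
    by (simp add: degree_gegen degree_gegen_base assms coeff_gegen_base mult.commute)
qed

lemma poly_gegen_1: "poly (gegen m k) 1 = 1"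
  by (simp add: gegen_def poly_pcompose poly_0_coeff_0 coeff_gegen_base)

text \<open>Comparing coefficients of u^r turns this equation into the recursion of
  \<open>gegen_coeff\<close>, cleared of its denominator.\<close>

lemma gegen_base_ode:
  assumes "m \<ge> 2"
  shows "[:0, 2, - 1:] * pderiv (pderiv (gegen_base m k)) + Polynomial.smult (real m - 1) ([:1, - 1:] * pderiv (gegen_base m k))
    + Polynomial.smult (real k * (real k + real m - 2)) (gegen_base m k) = 0"
proof (rule poly_eqI)
  fix r
  let ?a = "gegen_coeff m k"
  have "(real r + 1) * (2 * real r + real m - 1) * ?a (Suc r) =
      - (real k - real r) * (real k + real r + real m - 2) * ?a r"
    using assms by simp (simp add: algebra_simps)
  then show "coeff ([:0, 2, - 1:] * pderiv (pderiv (gegen_base m k)) + Polynomial.smult (real m - 1) ([:1, - 1:] * pderiv (gegen_base m k))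
    + Polynomial.smult (real k * (real k + real m - 2)) (gegen_base m k)) r = coeff 0 r"
    by (cases r; cases "r - 1")
       (simp_all add: coeff_pderiv coeff_gegen_base algebra_simps coeff_pCons del: gegen_coeff.simps(2) split: nat.splits)
qed

lemma gegen_ode:
  assumes "m \<ge> 2"
  shows "[:1, 0, - 1:] * pderiv (pderiv (gegen m k)) - Polynomial.smult (real m - 1) ([:0, 1:] * pderiv (gegen m k))
    + Polynomial.smult (real k * (real k + real m - 2)) (gegen m k) = 0"
proof -
  have d: "pderiv (gegen m k) = - pcompose (pderiv (gegen_base m k)) [:1, - 1:]"
    "pderiv (pderiv (gegen m k)) = pcompose (pderiv (pderiv (gegen_base m k))) [:1, - 1:]"
    by (simp_all add: gegen_def pderiv_pcompose_linear pderiv_minus)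
  have "poly ([:0, 2, - 1:] * pderiv (pderiv (gegen_base m k)) + Polynomial.smult (real m - 1) ([:1, - 1:] * pderiv (gegen_base m k))
    + Polynomial.smult (real k * (real k + real m - 2)) (gegen_base m k)) (1 - x) = 0" for x
    by (simp only: gegen_base_ode [OF assms] poly_0)
  then show ?thesis
    \<comment> \<open>The second derivative is rewritten first, because \<open>d(1)\<close> would
      also match inside it.\<close>
    unfolding d(2) unfolding d(1) unfolding gegen_def
    by (intro iffD1 [OF poly_eq_poly_eq_iff] ext) (simp add: poly_pcompose algebra_simps)
qed

text \<open>The differential equation read off at the power \<open>j\<close> of t, now expanded at
  0: with \<open>m = card S\<close> this is the harmonicity condition of
  \<open>laplacian_zonal\<close>.\<close>

lemma gegen_coeff_rec:
  assumes "m \<ge> 2"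
  shows "(real j + 2) * (real j + 1) * coeff (gegen m k) (j + 2)
     + (real k - real j) * (real k + real j + real m - 2) * coeff (gegen m k) j = 0"
proof -
  let ?p = "gegen m k"
  have "coeff ([:1, 0, - 1:] * pderiv (pderiv ?p) - Polynomial.smult (real m - 1) ([:0, 1:] * pderiv ?p)
    + Polynomial.smult (real k * (real k + real m - 2)) ?p) j = 0"
    by (simp only: gegen_ode [OF assms] coeff_0)
  then show ?thesis
    by (cases j; cases "j - 1") (simp_all add: coeff_pderiv algebra_simps coeff_pCons)
qed

section \<open>Orthogonality and uniqueness\<close>

definition gegen_weight :: "nat \<Rightarrow> real \<Rightarrow> real" where
  "gegen_weight m t = (1 - t\<^sup>2) powr ((real m - 3) / 2)"

text \<open>Sturm-Liouville argument: by the differential equation of P = \<open>gegen m k\<close>,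
  the integrand is minus the derivative of (1 - t^2)^((m-1)/2) (P' q - P q'), which vanishes at both
  end points.\<close>

lemma gegen_self_adjoint:
  assumes m: "m \<ge> 2"
  shows "((\<lambda>t. gegen_weight m t * poly (gegen m k) t *
     (real k * (real k + real m - 2) * poly q t + (1 - t\<^sup>2) * poly (pderiv (pderiv q)) t
       - (real m - 1) * t * poly (pderiv q) t)) has_integral 0) {-1..1}"
proof -
  let ?P = "gegen m k" and ?a = "(real m - 1) / 2"
  define h where "h = pderiv ?P * q - ?P * pderiv q"
  define G where "G t = (1 - t\<^sup>2) powr ?a * poly h t" for t :: real
  define D where "D t = ?a * (1 - t\<^sup>2) powr (?a - 1) * (- 2 * t) * poly h t + poly (pderiv h) t * (1 - t\<^sup>2) powr ?a" for t :: real
  have "(D has_integral G 1 - G (- 1)) {-1..1}"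
  \<comment> \<open>For \<open>m = 2\<close> the power of 1 - t^2 is a square root, not
    differentiable at the end points; continuity there is enough.\<close>
  proof (rule fundamental_theorem_of_calculus_interior)
    show "continuous_on {-1..1} G"
      unfolding G_def using m
      by (intro continuous_intros continuous_on_powr') (auto simp: abs_square_le_1 abs_le_iff)
    fix t :: real assume t: "t \<in> {-1<..<1}"
    then have pos: "1 - t\<^sup>2 > 0" by (simp add: abs_square_less_1 abs_less_iff)
    have "((\<lambda>t. (1 - t\<^sup>2) powr ?a) has_real_derivative ?a * (1 - t\<^sup>2) powr (?a - of_nat 1) * (- 2 * t)) (at t)"
      by (rule DERIV_fun_powr [where g = "\<lambda>t. 1 - t\<^sup>2", OF _ pos]) (auto intro!: derivative_eq_intros)
    from DERIV_mult [OF this poly_DERIV [of h]]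
    show "(G has_vector_derivative D t) (at t)"
      by (simp add: G_def [abs_def] D_def has_real_derivative_iff_has_vector_derivative [symmetric])
  qed simp
  then have D: "((\<lambda>t. - D t) has_integral 0) {-1..1}"
    using has_integral_neg [of D 0] by (simp add: G_def)
  show ?thesis
  proof (rule has_integral_spike [OF _ _ D])
    show "negligible {-1, 1 :: real}" by simp
    fix t :: real assume "t \<in> {-1..1} - {-1, 1}"
    then have pos: "1 - t\<^sup>2 > 0" by (simp add: abs_square_less_1 abs_less_iff)
    have "(1 - t\<^sup>2) powr ?a = (1 - t\<^sup>2) powr ((real m - 3) / 2 + 1)"
      by (rule arg_cong) (simp add: field_simps)
    also have "\<dots> = gegen_weight m t * (1 - t\<^sup>2)"
      using pos by (simp add: powr_add gegen_weight_def)
    finally have w1: "(1 - t\<^sup>2) powr ?a = gegen_weight m t * (1 - t\<^sup>2)" .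
    have w2: "(1 - t\<^sup>2) powr (?a - 1) = gegen_weight m t"
      unfolding gegen_weight_def by (rule arg_cong) (simp add: field_simps)
    have "poly ([:1, 0, - 1:] * pderiv (pderiv ?P) - Polynomial.smult (real m - 1) ([:0, 1:] * pderiv ?P)
        + Polynomial.smult (real k * (real k + real m - 2)) ?P) t = 0"
      by (simp only: gegen_ode [OF m] poly_0)
    then have ode: "real k * (real k + real m - 2) * poly ?P t =
       (real m - 1) * t * poly (pderiv ?P) t - (1 - t\<^sup>2) * poly (pderiv (pderiv ?P)) t"
      by (simp add: algebra_simps power2_eq_square)
    have "gegen_weight m t * poly ?P t *
     (real k * (real k + real m - 2) * poly q t + (1 - t\<^sup>2) * poly (pderiv (pderiv q)) t
       - (real m - 1) * t * poly (pderiv q) t) =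
      gegen_weight m t * ((real k * (real k + real m - 2) * poly ?P t) * poly q t + poly ?P t * ((1 - t\<^sup>2) * poly (pderiv (pderiv q)) t
       - (real m - 1) * t * poly (pderiv q) t))"
      by (simp add: algebra_simps)
    also have "\<dots> = - D t"
      unfolding D_def w1 w2 ode
      by (simp add: h_def pderiv_diff pderiv_mult field_simps)
    finally show "gegen_weight m t * poly ?P t *
     (real k * (real k + real m - 2) * poly q t + (1 - t\<^sup>2) * poly (pderiv (pderiv q)) t
       - (real m - 1) * t * poly (pderiv q) t) = - D t" .
  qed
qed

text \<open>For q = t^j, self-adjointness gives a multiple of t^j with factor k(k+m-2) - j(j+m-2),
  plus j(j-1) t^(j-2). The factor is nonzero for \<open>j < k\<close>, and the lower power is
  orthogonal by induction.\<close>

lemma gegen_orthogonal_monom: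
  assumes m: "m \<ge> 2" and "j < k"
  shows "((\<lambda>t. gegen_weight m t * poly (gegen m k) t * t ^ j) has_integral 0) {-1..1}"
  using assms(2)
proof (induction j rule: less_induct)
  case (less j)
  let ?w = "\<lambda>t. gegen_weight m t * poly (gegen m k) t"
  let ?c = "real k * (real k + real m - 2) - real j * (real j + real m - 2)"
  have "?c = (real k - real j) * (real k + real j + real m - 2)"
    by (simp add: algebra_simps)
  then have c: "?c \<noteq> 0" using less.prems m by simp
  have 1: "((\<lambda>t. ?w t * (?c * t ^ j + real j * (real j - 1) * t ^ (j - 2))) has_integral 0) {-1..1}"
  proof (rule has_integral_eq [OF _ gegen_self_adjoint [OF m, of k "monom 1 j"]])
    fix t :: real
    show "?w t * (real k * (real k + real m - 2) * poly (monom 1 j) t +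
        (1 - t\<^sup>2) * poly (pderiv (pderiv (monom 1 j))) t - (real m - 1) * t * poly (pderiv (monom 1 j)) t) =
      ?w t * (?c * t ^ j + real j * (real j - 1) * t ^ (j - 2))"
    proof (cases "j < 2")
      case True
      then show ?thesis by (auto simp: less_2_cases_iff pderiv_monom poly_monom algebra_simps)
    next
      case False
      then obtain i where "j = Suc (Suc i)" by (metis add_2_eq_Suc le_Suc_ex not_less)
      then show ?thesis by (simp add: pderiv_monom poly_monom algebra_simps power2_eq_square)
    qed
  qed
  \<comment> \<open>For \<open>j < 2\<close> the coefficient is 0, so the truncated exponent
    \<open>j - 2\<close> does no harm.\<close>
  have 2: "((\<lambda>t. real j * (real j - 1) * (?w t * t ^ (j - 2))) has_integral 0) {-1..1}"
  proof (cases "j < 2")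
    case True
    then show ?thesis by (auto simp: less_2_cases_iff)
  next
    case False
    then show ?thesis
      using has_integral_mult_right [OF less.IH [of "j - 2"], of "real j * (real j - 1)"] less.prems by simp
  qed
  have "((\<lambda>t. ?c * (?w t * t ^ j)) has_integral 0) {-1..1}"
    using has_integral_diff [OF 1 2] by (simp add: algebra_simps)
  from has_integral_mult_right [OF this, of "1 / ?c"] c
  show ?case by simp
qed

lemma gegen_orthogonal:
  assumes m: "m \<ge> 2" and q: "degree q < k"
  shows "((\<lambda>t. gegen_weight m t * poly (gegen m k) t * poly q t) has_integral 0) {-1..1}"
proof -
  have "((\<lambda>t. \<Sum>j\<le>degree q. coeff q j * (gegen_weight m t * poly (gegen m k) t * t ^ j)) has_integral
     (\<Sum>j\<le>degree q. coeff q j * 0)) {-1..1}"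
  proof (rule has_integral_sum)
    fix j assume "j \<in> {..degree q}"
    then show "((\<lambda>t. coeff q j * (gegen_weight m t * poly (gegen m k) t * t ^ j)) has_integral coeff q j * 0) {-1..1}"
      using has_integral_mult_right [OF gegen_orthogonal_monom [OF m, of j k], of "coeff q j"] q by simp
  qed simp
  then show ?thesis
    by (simp add: poly_altdef [of q] sum_distrib_left mult_ac)
qed

text \<open>The worst case is \<open>m = 2\<close>, where the weight is the derivative of arcsin; it
  dominates all the others on the interval.\<close>

lemma gegen_weight_integrable:
  assumes m: "m \<ge> 2"
  shows "(\<lambda>t. gegen_weight m t * poly q t) integrable_on {-1..1}"
proof -
  have as: "((\<lambda>t. inverse (sqrt (1 - t\<^sup>2))) has_integral arcsin 1 - arcsin (- 1)) {-1..1}"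
  proof (rule fundamental_theorem_of_calculus_interior)
    show "continuous_on {-1..1} arcsin" by (rule continuous_on_arcsin')
    fix t :: real assume "t \<in> {-1<..<1}"
    then show "(arcsin has_vector_derivative inverse (sqrt (1 - t\<^sup>2))) (at t)"
      by (simp add: DERIV_arcsin has_real_derivative_iff_has_vector_derivative [symmetric])
  qed simp
  have "compact (poly q ` {-1..1})"
    by (intro compact_continuous_image continuous_intros) auto
  then have "bounded (poly q ` {-1..1})"
    by (rule compact_imp_bounded)
  then obtain K where "\<forall>x \<in> poly q ` {-1..1}. norm x \<le> K"
    unfolding bounded_iff by (elim exE)
  then have K: "\<bar>poly q t\<bar> \<le> K" if "t \<in> {-1..1}" for t
    using that by auto
  have int: "(\<lambda>t. K * inverse (sqrt (1 - t\<^sup>2))) integrable_on {-1..1}"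
    using has_integral_mult_right [OF as, of K] by (auto simp: integrable_on_def)
  show ?thesis
  proof (rule measurable_bounded_by_integrable_imp_integrable_real [OF _ int])
    show "(\<lambda>t. gegen_weight m t * poly q t) \<in> borel_measurable (lebesgue_on {-1..1})"
    proof -
      have "(\<lambda>t. gegen_weight m t * poly q t) \<in> borel_measurable borel"
        unfolding gegen_weight_def poly_altdef by measurable
      then show ?thesis
        by (simp add: measurable_completion measurable_restrict_space1)
    qed
    fix t :: real assume t: "t \<in> {-1..1}"
    show "\<bar>gegen_weight m t * poly q t\<bar> \<le> K * inverse (sqrt (1 - t\<^sup>2))"
    \<comment> \<open>At the end points both sides are 0, by the conventions
      \<open>0 powr a = 0\<close> and \<open>inverse 0 = 0\<close>.\<close>
    proof (cases "1 - t\<^sup>2 = 0")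
      case True
      then show ?thesis by (simp add: gegen_weight_def)
    next
      case False
      have "t\<^sup>2 \<le> 1" using t by (simp add: abs_square_le_1 abs_le_iff)
      with False have pos: "0 < 1 - t\<^sup>2" "1 - t\<^sup>2 \<le> 1" by auto
      have "gegen_weight m t \<le> (1 - t\<^sup>2) powr (- (1 / 2))"
        unfolding gegen_weight_def by (rule powr_mono') (use m pos in auto)
      also have "\<dots> = inverse (sqrt (1 - t\<^sup>2))"
        using pos by (simp add: powr_minus powr_half_sqrt)
      finally have "gegen_weight m t \<le> inverse (sqrt (1 - t\<^sup>2))" .
      then have "gegen_weight m t * \<bar>poly q t\<bar> \<le> inverse (sqrt (1 - t\<^sup>2)) * K"
        by (intro mult_mono K t) (use pos in auto)
      then show ?thesis by (simp add: abs_mult gegen_weight_def mult.commute)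
    qed
  qed simp
qed

text \<open>On [-1/2, 1/2] the weight is continuous and positive, so the integrand vanishes there
  pointwise and \<open>r\<close> has infinitely many roots.\<close>

lemma gegen_weight_definite:
  assumes m: "m \<ge> 2" and 0: "integral {-1..1} (\<lambda>t. gegen_weight m t * poly r t * poly r t) = 0"
  shows "r = 0"
proof (rule ccontr)
  assume "r \<noteq> 0"
  let ?f = "\<lambda>t. gegen_weight m t * poly r t * poly r t"
  have int: "?f integrable_on {-1..1}"
    using gegen_weight_integrable [OF m, of "r * r"] by (simp add: mult.assoc)
  have nonneg: "?f t \<ge> 0" for t
    by (simp add: gegen_weight_def mult.assoc)
  have int': "?f integrable_on {-1/2..1/2}"
    by (rule integrable_subinterval_real [OF int]) auto
  have "integral {-1/2..1/2} ?f \<le> integral {-1..1} ?f"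
    by (rule integral_subset_le [OF _ int' int]) (auto simp: nonneg)
  moreover have "integral {-1/2..1/2} ?f \<ge> 0"
    by (rule integral_nonneg [OF int']) (rule nonneg)
  ultimately have "(?f has_integral 0) (cbox (-1/2) (1/2))"
    using int' 0 by (simp add: has_integral_iff)
  moreover have sq: "1 - t\<^sup>2 > 0" if "t \<in> {-1/2..1/2}" for t :: real
    using that by (auto simp: abs_square_less_1 abs_less_iff)
  have "continuous_on (cbox (-1/2) (1/2)) ?f"
    unfolding gegen_weight_def
  proof (intro continuous_intros ballI)
    fix t :: real assume "t \<in> cbox (-1/2) (1/2)"
    then show "1 - t\<^sup>2 \<noteq> 0" using sq [of t] by simp
  qed
  ultimately have "?f t = 0" if "t \<in> {-1/2..1/2}" for t
    using has_integral_0_cbox_imp_0 [of "-1/2" "1/2" ?f t] that nonneg by auto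
  then have "poly r t = 0" if "t \<in> {-1/2..1/2}" for t
    using that sq [OF that] by (force simp: gegen_weight_def)
  then have "{-1/2..1/2} \<subseteq> {t. poly r t = 0}" by auto
  moreover have "infinite {-1/2..1/2 :: real}" by (simp add: infinite_Icc_iff)
  ultimately show False
    using poly_roots_finite [OF \<open>r \<noteq> 0\<close>] finite_subset by blast
qed

lemma gegenbauer_eq_gegen:
  assumes m: "m \<ge> 2"
  shows "gegenbauer m k = gegen m k"
  unfolding gegenbauer_def gegen_weight_def [symmetric]
proof (rule the_equality)
  show "degree (gegen m k) = k \<and> poly (gegen m k) 1 = 1 \<and>
    (\<forall>q. degree q < k \<longrightarrow> integral {-1..1} (\<lambda>t. gegen_weight m t * poly (gegen m k) t * poly q t) = 0)"
    using gegen_orthogonal [OF m] by (auto simp: degree_gegen m poly_gegen_1 integral_unique)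
  fix p assume p: "degree p = k \<and> poly p 1 = 1 \<and>
    (\<forall>q. degree q < k \<longrightarrow> integral {-1..1} (\<lambda>t. gegen_weight m t * poly p t * poly q t) = 0)"
  \<comment> \<open>Subtracting this multiple cancels the leading terms. The difference
    \<open>r\<close> has degree below \<open>k\<close>, so it is orthogonal to both polynomials and
    hence to itself.\<close>
  define \<alpha> where "\<alpha> = lead_coeff p / coeff (gegen m k) k"
  define r where "r = p - Polynomial.smult \<alpha> (gegen m k)"
  have "r = 0"
  proof (rule ccontr)
    assume "r \<noteq> 0"
    have "coeff r k = 0"
      using lead_coeff_gegen [OF m, of k] p by (simp add: r_def \<alpha>_def)
    moreover have "degree r \<le> k"
      unfolding r_def using p degree_gegen [OF m, of k] 
      by (intro degree_diff_le) (auto intro: order.trans [OF degree_smult_le])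
    ultimately have deg: "degree r < k"
      using \<open>r \<noteq> 0\<close> by (metis le_neq_implies_less leading_coeff_0_iff)
    \<comment> \<open>A vanishing \<open>integral\<close> says nothing without integrability,
      because 0 is also its default value.\<close>
    have "(\<lambda>t. gegen_weight m t * poly p t * poly r t) integrable_on {-1..1}"
      using gegen_weight_integrable [OF m, of "p * r"] by (simp add: mult.assoc)
    then have 1: "((\<lambda>t. gegen_weight m t * poly p t * poly r t) has_integral 0) {-1..1}"
      using p deg by (simp add: has_integral_iff)
    have "((\<lambda>t. gegen_weight m t * poly r t * poly r t) has_integral 0) {-1..1}"
      using has_integral_diff [OF 1 has_integral_mult_right [OF gegen_orthogonal [OF m deg], of \<alpha>]]
      by (simp add: r_def algebra_simps)
    then have "r = 0"
      using gegen_weight_definite [OF m] by (simp add: integral_unique)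
    with \<open>r \<noteq> 0\<close> show False by simp
  qed
  then have "p = Polynomial.smult \<alpha> (gegen m k)" by (simp add: r_def)
  moreover from this p have "\<alpha> = 1" by (simp add: poly_gegen_1)
  ultimately show "p = gegen m k" by simp
qed

section \<open>Positivity of the triple sums\<close>

lemma homog_eval_zonal:
  "homog_eval P k (sinner S x y) (sinner S x x * sinner S y y) = zonal S (coeff P) k y x"
proof -
  have "homog_eval P k (sinner S x y) (sinner S x x * sinner S y y) =
     (\<Sum>j\<in>{j\<in>{..k}. even (k - j)}. coeff P j * sinner S x y ^ j *
        (sinner S x x * sinner S y y) ^ ((k - j) div 2))"
    unfolding homog_eval_def by (subst sum.inter_filter) (auto intro: sum.cong)
  also have "\<dots> = zonal S (coeff P) k y x"
    unfolding zonal_def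
  \<comment> \<open>The exponents up to \<open>k\<close> with the parity of \<open>k\<close> are the
    numbers \<open>k - 2 * i\<close>.\<close>
  proof (rule sum.reindex_bij_witness [where i = "\<lambda>i. k - 2 * i" and j = "\<lambda>j. (k - j) div 2"])
    fix i assume "i \<in> {..k div 2}"
    then have i: "2 * i \<le> k" by auto
    then show "(k - (k - 2 * i)) div 2 = i" "k - 2 * i \<in> {j \<in> {..k}. even (k - j)}"
      by auto
  next
    fix j assume "j \<in> {j \<in> {..k}. even (k - j)}"
    then have j: "j \<le> k" "2 * ((k - j) div 2) = k - j" by auto
    then show "k - 2 * ((k - j) div 2) = j" "(k - j) div 2 \<in> {..k div 2}"
      by (auto intro: div_le_mono)
    show "coeff P (k - 2 * ((k - j) div 2)) * sinner S y y ^ ((k - j) div 2) *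
        (sinner S x x ^ ((k - j) div 2) * sinner S x y ^ (k - 2 * ((k - j) div 2))) =
      coeff P j * sinner S x y ^ j * (sinner S x x * sinner S y y) ^ ((k - j) div 2)"
      using j by (simp add: power_mult_distrib)
  qed
  finally show ?thesis .
qed

text \<open>The coefficient recursion makes the zonal polynomials harmonic in dimension
  \<open>card S\<close>, so they reproduce themselves. \<gamma> inverts the constant of
  \<open>fischer_zonal\<close>, positive because the leading coefficient is.\<close>

lemma zonal_gegenbauer:
  assumes S: "orthonormal S" and m: "card S \<ge> 2"
  obtains \<gamma> where "\<gamma> > 0"
    and "\<And>y z. homog_eval (gegenbauer (card S) k) k (sinner S y z) (sinner S y y * sinner S z z) =
      \<gamma> * fischer S k (zonal S (coeff (gegenbauer (card S) k)) k y)
                      (zonal S (coeff (gegenbauer (card S) k)) k z)"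
proof
  let ?c = "coeff (gegen (card S) k)"
  have f: "fischer S k (zonal S ?c k y) (zonal S ?c k z) = ?c k * (fact k)\<^sup>2 * zonal S ?c k z y" for y z
    using gegen_coeff_rec [OF m] by (intro fischer_zonal S) auto
  have pos: "?c k > 0" by (rule lead_coeff_gegen [OF m])
  then show "1 / (?c k * (fact k)\<^sup>2) > 0" by simp
  show "homog_eval (gegenbauer (card S) k) k (sinner S y z) (sinner S y y * sinner S z z) =
      1 / (?c k * (fact k)\<^sup>2) * fischer S k (zonal S (coeff (gegenbauer (card S) k)) k y)
                      (zonal S (coeff (gegenbauer (card S) k)) k z)" for y z
    using pos by (simp add: homog_eval_zonal gegenbauer_eq_gegen m f)
qed

text \<open>An orthonormal basis through \<open>c\<close>, with \<open>c\<close> removed. With x = c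
  . y and y' = c . z, the argument z - x y of the matrices Y_k becomes the inner product of two
  projected points.\<close>

lemma orthonormal_complement:
  fixes c :: "'a::euclidean_space"
  assumes c: "norm c = 1"
  obtains S where "orthonormal S" "card S = DIM('a) - 1"
    "\<And>y z. sinner S y z = inner y z - inner c y * inner c z"
proof -
  obtain B where B: "c \<in> B" "pairwise real_inner_class.orthogonal B" "\<And>x. x \<in> B \<Longrightarrow> norm x = 1"
    "independent B" "card B = DIM('a)" "span B = UNIV"
    using vector_in_orthonormal_basis [OF c] by metis
  have fin: "finite B" using B(4) independent_imp_finite by blast
  have "sinner (B - {c}) y z = inner y z - inner c y * inner c z" for y z
  proof -
    have "inner y z = inner y (\<Sum>b\<in>B. inner z b *\<^sub>R b)"
      using orthonormal_basis_expand [OF B(2,3) _ fin, of z] B(6) by simp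
    also have "\<dots> = (\<Sum>b\<in>B. inner y b * inner z b)"
      by (simp add: inner_sum_right mult.commute)
    also have "\<dots> = inner y c * inner z c + sinner (B - {c}) y z"
      unfolding sinner_def by (rule sum.remove [OF fin B(1)])
    finally show ?thesis by (simp add: inner_commute)
  qed
  moreover have "orthonormal (B - {c})"
    using B(2,3) fin by (auto simp: orthonormal_def pairwise_def real_inner_class.orthogonal_def norm_eq_1)
  moreover have "card (B - {c}) = DIM('a) - 1"
    using B(1,5) fin by simp
  ultimately show ?thesis using that by blast
qed

lemma mat_inner_eq:
  assumes "M \<in> carrier_mat r r" "A \<in> carrier_mat r r"
  shows "mat_inner M A = (\<Sum>i<r. \<Sum>j<r. M $$ (i, j) * A $$ (i, j))"
proof -
  have "mat_inner M A = (\<Sum>j<r. \<Sum>i<r. M $$ (i, j) * A $$ (i, j))"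
    using assms by (simp add: mat_inner_def mat_trace_def scalar_prod_def atLeast0LessThan)
  also have "\<dots> = (\<Sum>i<r. \<Sum>j<r. M $$ (i, j) * A $$ (i, j))"
    by (rule sum.swap)
  finally show ?thesis .
qed

lemma pos_semidef_form:
  assumes "pos_semidef r M"
  shows "0 \<le> (\<Sum>i<r. \<Sum>j<r. M $$ (i, j) * v i * v j)"
proof -
  have M: "M \<in> carrier_mat r r" using assms by (simp add: pos_semidef_def)
  have "0 \<le> scalar_prod (vec r v) (M *\<^sub>v vec r v)"
    using assms by (simp add: pos_semidef_def)
  also have "\<dots> = (\<Sum>i<r. \<Sum>j<r. M $$ (i, j) * v i * v j)"
    using M by (simp add: scalar_prod_def atLeast0LessThan sum_distrib_left mult_ac)
  finally show ?thesis .
qed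

lemma Y_mat_carrier [simp]: "Y_mat n d k x y z \<in> carrier_mat (d - k + 1) (d - k + 1)"
  by (simp add: Y_mat_def)

lemma sum_Y_mat_nonneg:
  fixes c :: "real ^ 'n"
  assumes n: "CARD('n) \<ge> 3" and c: "norm c = 1"
    and M: "pos_semidef (d - k + 1) M" and C: "finite C"
    and unit: "\<And>y. y \<in> C \<Longrightarrow> norm y = 1"
  shows "0 \<le> (\<Sum>y\<in>C. \<Sum>z\<in>C. mat_inner M (Y_mat CARD('n) d k (inner c y) (inner c z) (inner y z)))"
proof -
  obtain S where S: "orthonormal S" "card S = DIM(real ^ 'n) - 1"
    "\<And>y z. sinner S y z = inner y z - inner c y * inner c z"
    using orthonormal_complement [OF c] by metis
  then have card: "card S = CARD('n) - 1" "card S \<ge> 2" using n by simp_all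
  have fin: "finite S" using S(1) by (simp add: orthonormal_def)
  let ?r = "d - k + 1"
  let ?Z = "zonal S (coeff (gegenbauer (card S) k)) k"
  obtain \<gamma> where \<gamma>: "\<gamma> > 0"
    "\<And>y z. homog_eval (gegenbauer (card S) k) k (sinner S y z) (sinner S y y * sinner S z z) =
      \<gamma> * fischer S k (?Z y) (?Z z)"
    using zonal_gegenbauer [OF S(1) card(2), of k] by metis
  \<comment> \<open>These are the vectors of the Gram matrix: its entry at \<open>(i, j)\<close> is,
    up to \<gamma>, the sum over \<open>y\<close> and \<open>z\<close> of the entries of the
    matrices Y_k.\<close>
  define V where "V i x = (\<Sum>y\<in>C. inner c y ^ i * ?Z y x)" for i x
  have V: "fischer S k (V i) (V j) =
      (\<Sum>y\<in>C. \<Sum>z\<in>C. inner c y ^ i * inner c z ^ j * fischer S k (?Z y) (?Z z))" for i j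
    unfolding V_def [abs_def]
    by (simp add: fischer_sum fischer_sum_right fischer_cmult fischer_cmult_right C
        real_polynomial_function_zonal fin real_polynomial_function.intros(2,4)
        sum_distrib_left mult.assoc)
  have Mc: "M \<in> carrier_mat ?r ?r" using M by (simp add: pos_semidef_def)
  have Y: "Y_mat CARD('n) d k (inner c y) (inner c z) (inner y z) $$ (i, j) =
      \<gamma> * (inner c y ^ i * inner c z ^ j * fischer S k (?Z y) (?Z z))"
    if "i < ?r" "j < ?r" "y \<in> C" "z \<in> C" for i j y z
  proof -
    have "inner y y = 1" "inner z z = 1" using unit that by (auto simp: norm_eq_1)
    then have "sinner S y y * sinner S z z = (1 - (inner c y)\<^sup>2) * (1 - (inner c z)\<^sup>2)"
      by (simp add: S(3) power2_eq_square)
    with \<gamma>(2) [of y z] show ?thesis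
      using that by (simp add: Y_mat_def S(3) card(1))
  qed
  have "(\<Sum>y\<in>C. \<Sum>z\<in>C. mat_inner M (Y_mat CARD('n) d k (inner c y) (inner c z) (inner y z))) =
      (\<Sum>y\<in>C. \<Sum>z\<in>C. \<Sum>i<?r. \<Sum>j<?r. M $$ (i, j) *
         (\<gamma> * (inner c y ^ i * inner c z ^ j * fischer S k (?Z y) (?Z z))))"
    by (intro sum.cong refl) (simp add: mat_inner_eq [OF Mc Y_mat_carrier] Y)
  also have "\<dots> = (\<Sum>y\<in>C. \<Sum>i<?r. \<Sum>j<?r. \<Sum>z\<in>C. M $$ (i, j) *
         (\<gamma> * (inner c y ^ i * inner c z ^ j * fischer S k (?Z y) (?Z z))))"
    by (subst sum.swap, subst (2) sum.swap, rule refl)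
  also have "\<dots> = (\<Sum>i<?r. \<Sum>j<?r. \<Sum>y\<in>C. \<Sum>z\<in>C. M $$ (i, j) *
         (\<gamma> * (inner c y ^ i * inner c z ^ j * fischer S k (?Z y) (?Z z))))"
    by (subst sum.swap, subst (2) sum.swap, rule refl)
  also have "\<dots> = \<gamma> * (\<Sum>i<?r. \<Sum>j<?r. M $$ (i, j) * fischer S k (V i) (V j))"
    by (simp only: V sum_distrib_left mult_ac)
  also have "\<dots> \<ge> 0"
    using \<gamma>(1) fischer_psd [OF pos_semidef_form [OF M], of S k V] by simp
  finally show ?thesis .
qed

section \<open>Sums over triples of code points\<close>

definition triple_sum :: "(real ^ 'n) set \<Rightarrow> (real \<Rightarrow> real \<Rightarrow> real \<Rightarrow> real) \<Rightarrow> real" where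
  "triple_sum C G = (\<Sum>x\<in>C. \<Sum>y\<in>C. \<Sum>z\<in>C. G (inner x y) (inner x z) (inner y z))"

lemma triple_sum_swap12: "triple_sum C (\<lambda>a b c. G b a c) = triple_sum C G"
  unfolding triple_sum_def
  by (rule sum.cong [OF refl], subst sum.swap) (simp add: inner_commute)

lemma triple_sum_swap23: "triple_sum C (\<lambda>a b c. G a c b) = triple_sum C G"
  unfolding triple_sum_def by (subst sum.swap) (simp add: inner_commute)

lemma triple_sum_add: "triple_sum C (\<lambda>a b c. G a b c + H a b c) = triple_sum C G + triple_sum C H"
  by (simp add: triple_sum_def sum.distrib)

lemma triple_sum_cmult: "triple_sum C (\<lambda>a b c. r * G a b c) = r * triple_sum C G"
  by (simp add: triple_sum_def sum_distrib_left)

text \<open>Renaming the three points permutes their three inner products in all six ways, so the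
  averaging in S_k is invisible to the sum.\<close>

lemma triple_sum_symmetrize:
  "triple_sum C (\<lambda>a b c. 1 / 6 * (G a b c + G a c b + G b a c + G b c a + G c a b + G c b a)) =
    triple_sum C G"
proof -
  have "triple_sum C (\<lambda>a b c. G b c a) = triple_sum C G"
    using triple_sum_swap12 [of C "\<lambda>a b c. G a c b"] triple_sum_swap23 [of C G] by simp
  moreover have "triple_sum C (\<lambda>a b c. G c a b) = triple_sum C G"
    using triple_sum_swap23 [of C "\<lambda>a b c. G b a c"] triple_sum_swap12 [of C G] by simp
  moreover have "triple_sum C (\<lambda>a b c. G c b a) = triple_sum C G"
    using triple_sum_swap12 [of C "\<lambda>a b c. G c a b"] calculation by simp
  ultimately show ?thesis
    unfolding triple_sum_cmult triple_sum_add
    by (simp add: triple_sum_swap12 [of C G] triple_sum_swap23 [of C G])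
qed

lemma mat_inner_S_mat:
  assumes "M \<in> carrier_mat (d - k + 1) (d - k + 1)"
  shows "mat_inner M (S_mat n d k x y z) = 1 / 6 *
    (mat_inner M (Y_mat n d k x y z) + mat_inner M (Y_mat n d k x z y) +
     mat_inner M (Y_mat n d k y x z) + mat_inner M (Y_mat n d k y z x) +
     mat_inner M (Y_mat n d k z x y) + mat_inner M (Y_mat n d k z y x))"
proof -
  have dims: "dim_row (Y_mat n d k x y z) = d - k + 1" "dim_col (Y_mat n d k x y z) = d - k + 1" for x y z
    by (simp_all add: Y_mat_def)
  have S: "S_mat n d k x y z \<in> carrier_mat (d - k + 1) (d - k + 1)"
    by (simp add: S_mat_def carrier_matI dims)
  have e: "M $$ (i, j) * S_mat n d k x y z $$ (i, j) = 1 / 6 *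
      (M $$ (i, j) * Y_mat n d k x y z $$ (i, j) + M $$ (i, j) * Y_mat n d k x z y $$ (i, j) +
       M $$ (i, j) * Y_mat n d k y x z $$ (i, j) + M $$ (i, j) * Y_mat n d k y z x $$ (i, j) +
       M $$ (i, j) * Y_mat n d k z x y $$ (i, j) + M $$ (i, j) * Y_mat n d k z y x $$ (i, j))"
    if "i < d - k + 1" "j < d - k + 1" for i j
    using that by (simp add: S_mat_def dims distrib_left)
  show ?thesis
    unfolding mat_inner_eq [OF assms S] mat_inner_eq [OF assms Y_mat_carrier]
    by (simp only: sum.distrib [symmetric] sum_distrib_left)
       (intro sum.cong refl, simp only: lessThan_iff e distrib_left)
qed

text \<open>After S_k is replaced by Y_k, the part of the sum with fixed first point is an instance
  of \<open>sum_Y_mat_nonneg\<close>.\<close>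

lemma triple_sum_mat_inner_nonneg:
  fixes C :: "(real ^ 'n) set"
  assumes n: "CARD('n) \<ge> 3" and M: "pos_semidef (d - k + 1) M"
    and C: "finite C" "C \<subseteq> sphere 0 1"
  shows "0 \<le> triple_sum C (\<lambda>x y z. mat_inner M (S_mat CARD('n) d k x y z))"
proof -
  have "M \<in> carrier_mat (d - k + 1) (d - k + 1)" using M by (simp add: pos_semidef_def)
  then have "triple_sum C (\<lambda>x y z. mat_inner M (S_mat CARD('n) d k x y z)) =
      triple_sum C (\<lambda>x y z. mat_inner M (Y_mat CARD('n) d k x y z))"
    by (simp only: mat_inner_S_mat triple_sum_symmetrize)
  also have "\<dots> \<ge> 0"
    unfolding triple_sum_def
    by (intro sum_nonneg sum_Y_mat_nonneg n M C(1)) (use C(2) in auto)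
  finally show ?thesis .
qed

lemma gegenbauer_0: "m \<ge> 2 \<Longrightarrow> gegenbauer m 0 = 1"
  by (simp add: gegenbauer_eq_gegen gegen_def gegen_base_def pcompose_pCons monom_0)

text \<open>The corner entry of Y_0 is the constant Gegenbauer polynomial of degree 0. Each triple
  thus contributes \<open>f0\<close>, which produces the cube of the code size.\<close>

lemma mat_inner_E0_S_mat:
  assumes "n \<ge> 3"
  shows "mat_inner (E0_mat (d + 1)) (S_mat n d 0 x y z) = 1"
proof -
  have "mat_inner (E0_mat (d + 1)) (Y_mat n d 0 x y z) = 1" for x y z
  proof -
    have Y: "Y_mat n d 0 x y z $$ (0, 0) = 1"
      using assms by (simp add: Y_mat_def homog_eval_def gegenbauer_0)
    have "mat_inner (E0_mat (d + 1)) (Y_mat n d 0 x y z) =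
        (\<Sum>i<d + 1. \<Sum>j<d + 1. E0_mat (d + 1) $$ (i, j) * Y_mat n d 0 x y z $$ (i, j))"
      using Y_mat_carrier [of n d 0] by (intro mat_inner_eq) (simp_all add: E0_mat_def)
    also have "\<dots> = (\<Sum>i<d + 1. \<Sum>j<d + 1. if j = 0 then (if i = 0 then 1 else 0) else 0)"
      by (intro sum.cong refl) (use Y in \<open>auto simp: E0_mat_def\<close>)
    also have "\<dots> = 1" by (simp add: sum.delta)
    finally show ?thesis .
  qed
  then show ?thesis
    by (subst mat_inner_S_mat) (simp_all add: E0_mat_def)
qed

lemma BV_triple_sum:
  fixes C :: "(real ^ 'n) set"
  assumes n: "CARD('n) \<ge> 3" and F: "F \<in> BV CARD('n) f0"
    and C: "finite C" "C \<subseteq> sphere 0 1"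
  shows "f0 * real (card C) ^ 3 \<le> triple_sum C F"
proof -
  let ?S = "\<lambda>d k x y z. S_mat CARD('n) d k x y z"
  obtain d M where M: "\<And>k. k \<le> d \<Longrightarrow> pos_semidef (d - k + 1) (M k)"
    and M0: "pos_semidef (d + 1) (M 0 - f0 \<cdot>\<^sub>m E0_mat (d + 1))"
    and F: "\<And>x y z. F x y z = (\<Sum>k\<le>d. mat_inner (M k) (?S d k x y z))"
    using F by (auto simp: BV_def)
  let ?M0 = "M 0 - f0 \<cdot>\<^sub>m E0_mat (d + 1)"
  have E: "E0_mat (d + 1) \<in> carrier_mat (d + 1) (d + 1)" by (simp add: E0_mat_def)
  have M0c: "M 0 \<in> carrier_mat (d + 1) (d + 1)" using M [of 0] by (simp add: pos_semidef_def)
  have M0c': "?M0 \<in> carrier_mat (d + 1) (d + 1)" using M0 by (simp add: pos_semidef_def)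
  have Sc: "?S d 0 x y z \<in> carrier_mat (d + 1) (d + 1)" for x y z
    using Y_mat_carrier [of "CARD('n)" d 0] by (simp add: S_mat_def)
  have split0: "mat_inner (M 0) (?S d 0 x y z) = mat_inner ?M0 (?S d 0 x y z) + f0" for x y z
  proof -
    have "mat_inner (M 0) (?S d 0 x y z) = mat_inner ?M0 (?S d 0 x y z) +
        f0 * mat_inner (E0_mat (d + 1)) (?S d 0 x y z)"
      unfolding mat_inner_eq [OF M0c Sc] mat_inner_eq [OF M0c' Sc] mat_inner_eq [OF E Sc]
      unfolding sum_distrib_left sum.distrib [symmetric]
      by (intro sum.cong refl) (use M0c E in \<open>simp add: algebra_simps\<close>)
    then show ?thesis using mat_inner_E0_S_mat [OF n, of d x y z] by simp
  qed
  have F': "F x y z = f0 + (mat_inner ?M0 (?S d 0 x y z) + (\<Sum>k\<in>{..d} - {0}. mat_inner (M k) (?S d k x y z)))" for x y z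
    unfolding F by (subst sum.remove [of _ 0]) (simp_all add: split0)
  have "triple_sum C F = f0 * real (card C) ^ 3 + (triple_sum C (\<lambda>x y z. mat_inner ?M0 (?S d 0 x y z)) +
     triple_sum C (\<lambda>x y z. \<Sum>k\<in>{..d} - {0}. mat_inner (M k) (?S d k x y z)))"
  proof -
    have "triple_sum C (\<lambda>x y z. f0) = f0 * real (card C) ^ 3"
      by (simp add: triple_sum_def power3_eq_cube)
    moreover have "F = (\<lambda>x y z. f0 + (mat_inner ?M0 (?S d 0 x y z) + (\<Sum>k\<in>{..d} - {0}. mat_inner (M k) (?S d k x y z))))"
      by (intro ext) (rule F')
    ultimately show ?thesis by (simp add: triple_sum_add)
  qed
  also have "triple_sum C (\<lambda>x y z. \<Sum>k\<in>{..d} - {0}. mat_inner (M k) (?S d k x y z)) =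
      (\<Sum>k\<in>{..d} - {0}. triple_sum C (\<lambda>x y z. mat_inner (M k) (?S d k x y z)))"
    unfolding triple_sum_def by (simp only: sum.swap [of _ "{..d} - {0}"])
  finally show ?thesis
    using triple_sum_mat_inner_nonneg [OF n _ C, of d 0 ?M0] M0
      sum_nonneg [of "{..d} - {0}" "\<lambda>k. triple_sum C (\<lambda>x y z. mat_inner (M k) (?S d k x y z))"]
      triple_sum_mat_inner_nonneg [OF n M C]
    by simp
qed

section \<open>Bounds for spherical codes\<close>

text \<open>Cauchy-Schwarz for the projections of \<open>y\<close> and \<open>z\<close> to the
  complement of \<open>x\<close>. It places triples of distinct code points in
  \<open>D_set\<close>.\<close>

lemma gram_det_nonneg:
  fixes x y z :: "'a::real_inner"
  assumes "norm x = 1" "norm y = 1" "norm z = 1"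
  shows "0 \<le> 1 + 2 * inner x y * inner x z * inner y z
    - (inner x y)\<^sup>2 - (inner x z)\<^sup>2 - (inner y z)\<^sup>2"
proof -
  have 1: "inner x x = 1" "inner y y = 1" "inner z z = 1"
    using assms by (auto simp: norm_eq_1)
  let ?y = "y - inner x y *\<^sub>R x" and ?z = "z - inner x z *\<^sub>R x"
  have eq: "inner ?y ?z = inner y z - inner x y * inner x z"
    "inner ?y ?y = 1 - (inner x y)\<^sup>2" "inner ?z ?z = 1 - (inner x z)\<^sup>2"
    by (simp_all add: inner_diff 1 inner_commute power2_eq_square)
  show ?thesis
    using Cauchy_Schwarz_ineq [of ?y ?z] unfolding eq
    by (simp add: power2_eq_square algebra_simps)
qed

text \<open>Serves to make the maximum in \<open>A_max\<close> one over a finite set. The sphere is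
  covered by finitely many balls, each too small for two code points.\<close>

lemma spherical_code_card_bounded:
  assumes \<theta>: "0 < \<theta>" "\<theta> \<le> pi"
  obtains K where "\<And>N C. spherical_code N \<theta> (C :: (real ^ 'n) set) \<Longrightarrow> N \<le> K"
proof -
  have "cos \<theta> < 1"
    using cos_monotone_0_pi [of 0 \<theta>] \<theta> by simp
  \<comment> \<open>Half the distance of two unit vectors with inner product
    \<open>cos \<theta>\<close>, the least distance allowed in a code.\<close>
  define \<delta> where "\<delta> = sqrt (2 - 2 * cos \<theta>) / 2"
  have \<delta>: "\<delta> > 0" "(2 * \<delta>)\<^sup>2 = 2 - 2 * cos \<theta>"
    using \<open>cos \<theta> < 1\<close> by (simp_all add: \<delta>_def)
  have "\<forall>e>0. \<exists>k. finite k \<and> sphere (0 :: real ^ 'n) 1 \<subseteq> (\<Union>x\<in>k. ball x e)"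
    using compact_sphere [of "0 :: real ^ 'n" 1] unfolding compact_eq_totally_bounded by (rule conjunct2)
  then obtain k where k: "finite k" "sphere (0 :: real ^ 'n) 1 \<subseteq> (\<Union>x\<in>k. ball x \<delta>)"
    using \<delta>(1) by metis
  have "N \<le> card k" if C: "spherical_code N \<theta> C" for N and C :: "(real ^ 'n) set"
  proof -
    have "\<forall>c\<in>C. \<exists>x\<in>k. dist x c < \<delta>"
    proof
      fix c assume "c \<in> C"
      then have "c \<in> (\<Union>x\<in>k. ball x \<delta>)"
        using C k(2) unfolding spherical_code_def by blast
      then show "\<exists>x\<in>k. dist x c < \<delta>" by auto
    qed
    then obtain f where f: "\<And>c. c \<in> C \<Longrightarrow> f c \<in> k" "\<And>c. c \<in> C \<Longrightarrow> dist (f c) c < \<delta>"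
      by metis
    have "inj_on f C"
    proof (rule inj_onI, rule ccontr)
      fix c c' assume c: "c \<in> C" "c' \<in> C" "f c = f c'" "c \<noteq> c'"
      then have "dist c c' < 2 * \<delta>"
        using f(2) [OF c(1)] f(2) [OF c(2)] dist_triangle2 [of c c' "f c"]
        by (simp add: dist_commute)
      then have "(dist c c')\<^sup>2 < (2 * \<delta>)\<^sup>2"
        by (intro power_strict_mono) auto
      moreover have "(dist c c')\<^sup>2 = 2 - 2 * inner c c'"
      proof -
        have "inner c c = 1" "inner c' c' = 1"
          using C c by (auto simp: spherical_code_def norm_eq_1)
        then show ?thesis
          by (simp add: dist_norm power2_norm_eq_inner inner_diff inner_commute)
      qed
      moreover have "inner c c' \<le> cos \<theta>"
        using C c by (auto simp: spherical_code_def)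
      ultimately show False using \<delta>(2) by simp
    qed
    then have "card C \<le> card k"
      using f(1) k(1) by (intro card_inj_on_le) auto
    then show ?thesis using C by (simp add: spherical_code_def)
  qed
  then show ?thesis using that by blast
qed

text \<open>An orthogonal map taking \<open>x\<close> to \<open>e\<close> turns the points of
  \<open>C\<close> with inner product in \<open>T\<close> into a code that competes in
  \<open>h_hat\<close>.\<close>

lemma sum_g_ext_le_h_hat:
  fixes e x :: "real ^ 'n"
  assumes \<theta>: "0 < \<theta>" "\<theta> \<le> pi" and e: "norm e = 1" and x: "norm x = 1"
    and C: "spherical_code N \<theta> C"
  shows "ereal (\<Sum>y\<in>C. g_ext T g (inner x y)) \<le> max 0 (h_hat e \<theta> T g)"
proof -
  obtain f where f: "orthogonal_transformation f" "f x = e"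
    using orthogonal_transformation_exists_1 [OF x e] by metis
  have f_inner: "inner (f u) (f v) = inner u v" for u v
    using f(1) by (simp add: orthogonal_transformation_def)
  have f_inj: "inj f" using f(1) by (rule orthogonal_transformation_inj)
  define Y where "Y = {y \<in> C. inner x y \<in> T}"
  have fin: "finite C" using C by (simp add: spherical_code_def)
  then have Y: "finite Y" "Y \<subseteq> C" by (simp_all add: Y_def)
  have "(\<Sum>y\<in>C. g_ext T g (inner x y)) = (\<Sum>y\<in>Y. g (inner x y))"
    unfolding Y_def g_ext_def by (rule sum.inter_filter [OF fin, symmetric])
  also have "\<dots> = H_sum e g (f ` Y)"
  proof -
    have "H_sum e g (f ` Y) = (\<Sum>y\<in>Y. g (inner e (f y)))"
      unfolding H_sum_def by (subst sum.reindex) (auto intro: inj_on_subset [OF f_inj])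
    then show ?thesis
      unfolding f(2) [symmetric] f_inner by simp
  qed
  finally have eq: "(\<Sum>y\<in>C. g_ext T g (inner x y)) = H_sum e g (f ` Y)" .
  show ?thesis
  \<comment> \<open>The empty selection has sum 0 and size 0, which is outside the range of
    \<open>h_hat\<close>; the maximum with 0 accounts for it.\<close>
  proof (cases "Y = {}")
    case True
    then have "(\<Sum>y\<in>C. g_ext T g (inner x y)) = 0" unfolding eq H_sum_def by simp
    then show ?thesis by (simp only: zero_ereal_def [symmetric] max.cobounded1)
  next
    case False
    have code: "spherical_code (card Y) \<theta> (f ` Y)"
    proof -
      have "norm (f y) = 1" if "y \<in> Y" for y
        using that C Y(2) f(1) by (auto simp: spherical_code_def orthogonal_transformation_norm)
      moreover have "inner (f y) (f y') \<le> cos \<theta>" if "y \<in> Y" "y' \<in> Y" "f y \<noteq> f y'" for y y'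
      proof -
        have "y \<in> C" "y' \<in> C" "y \<noteq> y'" using that Y(2) by auto
        then show ?thesis using C by (simp add: f_inner spherical_code_def)
      qed
      ultimately show ?thesis
        using Y(1) card_image [OF inj_on_subset [OF f_inj subset_UNIV], of Y]
        by (simp add: spherical_code_def image_subset_iff)
    qed
    have T: "inner c e \<in> T" if c: "c \<in> f ` Y" for c
    proof -
      obtain y where y: "y \<in> Y" "c = f y" using c by blast
      then have "inner c e = inner x y"
        using f_inner [of y x] by (simp add: f(2) inner_commute)
      then show ?thesis using y by (simp add: Y_def)
    qed
    obtain K where K: "\<And>N C. spherical_code N \<theta> (C :: (real ^ 'n) set) \<Longrightarrow> N \<le> K"
      using spherical_code_card_bounded [OF \<theta>] by metis
    have "finite {N. \<exists>C. spherical_code N \<theta> C \<and> (\<forall>c\<in>C. inner c e \<in> T)}"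
      by (rule finite_subset [OF _ finite_atMost [of K]]) (use K in blast)
    then have "card Y \<le> A_max e \<theta> T"
      unfolding A_max_def using code T by (intro Max_ge) blast+
    moreover have "1 \<le> card Y" using False Y(1) by (simp add: Suc_le_eq card_gt_0_iff)
    ultimately have m: "card Y \<in> {1..A_max e \<theta> T}" by simp
    have "ereal (H_sum e g (f ` Y)) \<le> h_val e (card Y) \<theta> T g"
      unfolding h_val_def by (rule SUP_upper) (simp add: Q_set_def code T)
    also have "\<dots> \<le> h_hat e \<theta> T g"
      unfolding h_hat_def by (rule SUP_upper [OF m])
    finally show ?thesis by (simp add: eq max.coboundedI2)
  qed
qed

text \<open>Only the triples with at least two equal entries meet the diagonal \<open>F x x 1\<close>; the multiples of
  \<open>B\<close> are counted by inclusion and exclusion, which leaves \<open>- 3 * B\<close> on the full diagonal.\<close>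

lemma F_class_triple_sum:
  fixes C :: "(real ^ 'n) set"
  assumes F: "F \<in> F_class n f0 T g B \<theta>" and T: "T \<subseteq> {-1..<1}" and C: "spherical_code N \<theta> C"
  shows "triple_sum C F \<le> real N * (F 1 1 1 + 3 * (real N - 1) * B) +
    3 * real N * (\<Sum>x\<in>C. \<Sum>y\<in>C. g_ext T g (inner x y))"
proof -
  let ?p = "\<lambda>x y. g_ext T g (inner x y)"
  have fin: "finite C" and card: "card C = N" using C by (auto simp: spherical_code_def)
  have unit: "norm x = 1" if "x \<in> C" for x using C that by (auto simp: spherical_code_def)
  have inner1: "inner x x = 1" if "x \<in> C" for x using unit [OF that] by (simp add: norm_eq_1)
  \<comment> \<open>\<open>T\<close> excludes 1, so a point paired with itself contributes
    nothing.\<close>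
  have p1: "g_ext T g 1 = 0"
    using T by (auto simp: g_ext_def)
  have range: "inner x y \<in> {-1..cos \<theta>}" if "x \<in> C" "y \<in> C" "x \<noteq> y" for x y
    using C that Cauchy_Schwarz_ineq2 [of x y] unit by (auto simp: spherical_code_def)
  have sym: "F a b c = F b a c" "F a b c = F a c b" for a b c
    using F unfolding F_class_def symmetric_polynomial3_def by blast+
  have diag: "F a a 1 \<le> B + 2 * g_ext T g a" if "a \<in> {-1..cos \<theta>}" for a
    using F that unfolding F_class_def by blast
  have off: "F a b c \<le> g_ext T g a + g_ext T g b + g_ext T g c" if "(a, b, c) \<in> D_set \<theta>" for a b c
    using F that unfolding F_class_def by blast
  have bound: "F (inner x y) (inner x z) (inner y z) \<le> ?p x y + ?p x z + ?p y z +
      B * (of_bool (x = y) + of_bool (x = z) + of_bool (y = z)) +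
      (F 1 1 1 - 3 * B) * (of_bool (x = y) * of_bool (x = z))"
    if xyz: "x \<in> C" "y \<in> C" "z \<in> C" for x y z
  proof -
    consider "x = y" "x = z" | "x = y" "x \<noteq> z" | "x \<noteq> y" "x = z" | "x \<noteq> y" "x \<noteq> z" "y = z"
      | "x \<noteq> y" "x \<noteq> z" "y \<noteq> z" by blast
    then show ?thesis
    proof cases
      case 1
      then show ?thesis using xyz by (simp add: inner1 p1 algebra_simps)
    next
      \<comment> \<open>Two coinciding points give the inner products 1, t, t in some order;
        symmetry of \<open>F\<close> brings the 1 to the last place.\<close>
      case 2
      have "F 1 (inner x z) (inner x z) = F (inner x z) (inner x z) 1"
        by (rule trans [OF sym(1) sym(2)])
      then show ?thesis
        using 2 xyz diag [OF range [of x z]] by (simp add: inner1 p1)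
    next
      case 3
      have "F (inner x y) 1 (inner x y) = F (inner x y) (inner x y) 1"
        by (rule sym(2))
      then show ?thesis
        using 3 xyz diag [OF range [of x y]] by (simp add: inner1 p1 inner_commute [of y])
    next
      case 4
      then show ?thesis
        using xyz diag [OF range [of x y]] by (simp add: inner1 p1)
    next
      case 5
      have "(inner x y, inner x z, inner y z) \<in> D_set \<theta>"
        using range [of x y] range [of x z] range [of y z] gram_det_nonneg [of x y z] unit xyz 5
        by (auto simp: D_set_def algebra_simps)
      from off [OF this] 5 show ?thesis by simp
    qed
  qed
  have "triple_sum C F \<le> (\<Sum>x\<in>C. \<Sum>y\<in>C. \<Sum>z\<in>C. ?p x y + ?p x z + ?p y z +
      B * (of_bool (x = y) + of_bool (x = z) + of_bool (y = z)) +
      (F 1 1 1 - 3 * B) * (of_bool (x = y) * of_bool (x = z)))"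
    unfolding triple_sum_def by (intro sum_mono bound)
  \<comment> \<open>Each of the three pair indicators sums to N^2 and the full diagonal to N, so
    \<open>B\<close> gets the factor 3 N^2 - 3 N.\<close>
  also have "\<dots> = real N * (F 1 1 1 + 3 * (real N - 1) * B) + 3 * real N * (\<Sum>x\<in>C. \<Sum>y\<in>C. ?p x y)"
  proof -
    have b: "(\<Sum>y\<in>C. c * of_bool (x = y)) = (c :: real)" if "x \<in> C" for x c
      using that fin by (simp add: of_bool_def if_distrib [of "(*) c"] sum.delta cong: if_cong)
    have 1: "(\<Sum>x\<in>C. \<Sum>y\<in>C. \<Sum>z\<in>C. ?p x y) = real N * (\<Sum>x\<in>C. \<Sum>y\<in>C. ?p x y)"
      "(\<Sum>x\<in>C. \<Sum>y\<in>C. \<Sum>z\<in>C. ?p x z) = real N * (\<Sum>x\<in>C. \<Sum>y\<in>C. ?p x y)"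
      "(\<Sum>x\<in>C. \<Sum>y\<in>C. \<Sum>z\<in>C. ?p y z) = real N * (\<Sum>x\<in>C. \<Sum>y\<in>C. ?p x y)"
      by (simp_all add: card sum_distrib_left)
    have xy: "(\<Sum>x\<in>C. \<Sum>y\<in>C. 1 * of_bool (x = y)) = real N"
      by (simp only: b card sum_constant mult_1_right cong: sum.cong)
    have 2: "(\<Sum>x\<in>C. \<Sum>y\<in>C. \<Sum>z\<in>C. of_bool (x = y) :: real) = real N * real N"
      "(\<Sum>x\<in>C. \<Sum>y\<in>C. \<Sum>z\<in>C. of_bool (x = z) :: real) = real N * real N"
      "(\<Sum>x\<in>C. \<Sum>y\<in>C. \<Sum>z\<in>C. of_bool (y = z) :: real) = real N * real N"
      using xy by (simp_all only: sum_constant card mult_1 sum_distrib_left [symmetric])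
    have 3: "(\<Sum>x\<in>C. \<Sum>y\<in>C. of_bool (x = y) * (\<Sum>z\<in>C. of_bool (x = z) :: real)) = real N"
    proof -
      have "(\<Sum>z\<in>C. of_bool (x = z) :: real) = 1" if "x \<in> C" for x
        using b [OF that, of 1] by simp
      then show ?thesis using xy by simp
    qed
    show ?thesis
      unfolding sum.distrib
      by (simp only: sum_distrib_left [symmetric] sum.distrib 1 2 3) (simp add: algebra_simps)
  qed
  finally show ?thesis .
qed

section \<open>Comparison of the lower and upper bounds of the triple sum\<close>

theorem theorem1:
  fixes e :: "real ^ 'n"
    and C :: "(real ^ 'n) set"
    and F :: "real \<Rightarrow> real \<Rightarrow> real \<Rightarrow> real"
    and g :: "real \<Rightarrow> real"
    and T :: "real set"
    and \<theta> f0 B :: real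
    and N :: nat
  assumes "CARD('n) \<ge> 3"
    and "0 < \<theta>" and "\<theta> \<le> pi"
    and "f0 > 0"
    and "T \<subseteq> {-1..<1}"
    and "F \<in> F_class CARD('n) f0 T g B \<theta>"
    and "norm e = 1"
    and "N \<ge> 1"
    and "spherical_code N \<theta> C"
  shows "ereal ((real N)\<^sup>2) \<le>
    (ereal (F 1 1 1 + 3 * (real N - 1) * B) + ereal (3 * real N) * max 0 (h_hat e \<theta> T g))
      / ereal f0"
proof -
  let ?h = "max 0 (h_hat e \<theta> T g)"
  have C: "finite C" "card C = N" "C \<subseteq> sphere 0 1"
    using assms(9) by (auto simp: spherical_code_def)
  have h: "ereal (\<Sum>y\<in>C. g_ext T g (inner x y)) \<le> ?h" if "x \<in> C" for x
    using sum_g_ext_le_h_hat [OF assms(2,3,7) _ assms(9)] C(3) that by auto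
  show ?thesis
  \<comment> \<open>Only a finite value needs the triple sum: for positive infinity the right-hand
    side is infinite, as \<open>N\<close> and \<open>f0\<close> are positive, and negative infinity
    is excluded by the maximum with 0.\<close>
  proof (cases ?h)
    case (real r)
    have "f0 * real N ^ 3 \<le> triple_sum C F"
      using BV_triple_sum [OF assms(1) _ C(1,3)] assms(6) C(2) by (auto simp: F_class_def)
    also have "\<dots> \<le> real N * (F 1 1 1 + 3 * (real N - 1) * B) +
        3 * real N * (\<Sum>x\<in>C. \<Sum>y\<in>C. g_ext T g (inner x y))"
      by (rule F_class_triple_sum [OF assms(6,5,9)])
    also have "\<dots> \<le> real N * (F 1 1 1 + 3 * (real N - 1) * B) + 3 * real N * (real N * r)"
    proof -
      have "(\<Sum>x\<in>C. \<Sum>y\<in>C. g_ext T g (inner x y)) \<le> (\<Sum>x\<in>C. r)"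
        using h by (intro sum_mono) (simp add: real)
      then show ?thesis by (intro add_left_mono mult_left_mono) (simp_all add: C(2))
    qed
    finally have "real N * (f0 * (real N)\<^sup>2) \<le>
        real N * (F 1 1 1 + 3 * (real N - 1) * B + 3 * real N * r)"
      by (simp add: power3_eq_cube power2_eq_square algebra_simps)
    \<comment> \<open>One factor \<open>N\<close> is cancelled, which takes the cubic bound to the
      quadratic one.\<close>
    then have "f0 * (real N)\<^sup>2 \<le> F 1 1 1 + 3 * (real N - 1) * B + 3 * real N * r"
      by (rule mult_left_le_imp_le) (use assms(8) in simp)
    then show ?thesis
      using assms(4) unfolding real by (simp add: field_simps)
  next
    case PInf
    then show ?thesis using assms(4,8) by simp
  next
    case MInf
    then have "0 \<le> (- \<infinity> :: ereal)" by (metis max.cobounded1)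
    then show ?thesis by simp
  qed
qed

end
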